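(* Let $X$ be a crystal 2-polygraph, and $\mathcal R^0(X)$ its rewriting system at highest weight. (i) If $\mathcal R^0(X)$ is terminating and locally confluent, then $X$ is terminating and confluent. (ii) If the critical branchings of $\mathcal R^0(X)$ are confluent, then $X$ is locally confluent.
   Context: Crystals. Fix a complex symmetrizable Kac–Moody algebra $\mathfrak g$ with weight lattice $P$, dominant weights $P^+$, simple roots $\alpha_i$ and simple coroots $\alpha_i^\vee$ ($i\in I$). A (normal) crystal is a set $\Gamma$ with maps $\mathrm{wt}:\Gamma\to P$, $\varepsilon_i,\varphi_i:\Gamma\to\mathbb Z$, $e_i,f_i:\Gamma\to\Gamma\sqcup\{0\}$ such that for all $x\in\Gamma$, $i\in I$: $\varphi_i(x)-\varepsilon_i(x)=\langle\mathrm{wt}(x),\alpha_i^\vee\rangle$; $\varepsilon_i(x)=\max\{n:e_i^n.x\ne0\}$ and $\varphi_i(x)=\max\{n:f_i^n.x\neq0\}$; $\mathrm{wt}(e_i.x)=\mathrm{wt}(x)+\alpha_i$ if $e_i.x\ne0$, and $\mathrm{wt}(f_i.x)=\mathrm{wt}(x)-\alpha_i$ if $f_i.x\neq0$; and $e_i.x=x'$ iff $f_i.x'=x$. The maps $e_i,f_i$ are the Kashiwara operators; $k$ denotes any one of them. A morphism of crystals is a map commuting with $\mathrm{wt},\varepsilon_i,\varphi_i,e_i,f_i$ (with $0\mapsto0$). "Crystal" always means a normal crystal each of whose connected components (under the Kashiwara operators) is isomorphic to the crystal $B(\lambda)$ of the irreducible highest weight module for some $\lambda\in P^+$. For a crystal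 $\Gamma$, $\Gamma^0$ is the set of its highest weight elements, i.e. of $x$ with $e_i.x=0$ for all $i$; each connected component contains exactly one, and all its elements are obtained from it by applying $f_i$'s. The tensor product $\Gamma_1\otimes\Gamma_2$ is $\Gamma_1\times\Gamma_2$ with additive weight, $e_i.(u\otimes v)=(e_i.u)\otimes v$ if $\varphi_i(u)\ge\varepsilon_i(v)$ and $u\otimes(e_i.v)$ otherwise, $f_i.(u\otimes v)=(f_i.u)\otimes v$ if $\varphi_i(u)>\varepsilon_i(v)$ and $u\otimes(f_i.v)$ otherwise (a tensor with a $0$ entry is $0$). The free monoid $\Gamma^*=\bigsqcup_{n\ge0}\Gamma^{\otimes n}$ is a crystal (the empty word has weight $0$ and is killed by all operators). Polygraphs. A 2-polygraph is a pair of sets $X=(X_1,X_2)$ with source and target maps $s_1,t_1:X_2\to X_1^*$. It is a crystal 2-polygraph if $X_1,X_2$ are crystals and $s_1,t_1$ are crystal morphisms. A rewriting step is $t\alpha v:ts_1(\alpha)v\Rightarrow tt_1(\alpha)v$ with $t,v\in X_1^*$, $\alpha\in X_2$; $\mathrm{Step}(X)$ is the set of these. It is a crystal: for $\gamma=t\alpha v$, $\mathrm{wt}(\gamma)=\mathrm{wt}(ts_1(\alpha)v)$, and $k.\gamma$ is $(k.t)\alpha v$, $t(k.\alpha)v$, $t\alpha(k.v)$ or $0$ according to whether $k.(ts_1(\alpha)v)$ is $(k.t)s_1(\alpha)v$, $t(k.s_1(\alpha))v$, $ts_1(\alpha)(k.v)$ or $0$. A rewriting sequence is a (possibly infinite)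 sequence of composable steps; a branching is a pair of finite rewriting sequences with the same source, local if both entries are steps; a branching is confluent if the targets of its entries can be rewritten by finite (possibly empty) rewriting sequences to a common word. $X$ is terminating if it has no infinite rewriting sequence, (locally) confluent if all its (local) branchings are confluent. A local branching is aspherical if of the form $(f,f)$; Peiffer if (up to exchanging entries) of the form $(fv,ug)$ with $f$ a step of source $u$ and $g$ a step of source $v$; otherwise overlapping. Order local branchings by the relation generated by $(f,g)\sqsubseteq(ufv,ugv)$, $u,v\in X_1^*$; a critical branching is an overlapping local branching minimal for $\sqsubseteq$; $\mathrm{Crit}(X)$ is the set of these. Highest weight system. $\mathcal R^0(X)$ is the abstract rewriting system with set of objects $(X_1^* )^0$ and set of steps $\mathrm{Step}(X)^0$ (the highest weight elements of $\mathrm{Step}(X)$, i.e. the steps whose source is a highest weight word). A rewriting sequence of $\mathcal R^0(X)$ is a (possibly infinite) sequence of composable steps in $\mathrm{Step}(X)^0$; a branching of $\mathcal R^0(X)$ is a pair of finite rewriting sequences of $\mathcal R^0(X)$ with the same source, local if both entries are steps in $\mathrm{Step}(X)^0$; it is confluent if the targets of its entries can be rewritten by finite (possibly empty) rewriting sequences of $\mathcal R^0(X)$ to a common word of $(X_1^* )^0$. $\mathcal R^0(X)$ is terminating if it has no infinite rewriting sequence, and (locally) confluent if all its (local) branchings are confluent; its critical branchings are $\mathrm{Crit}(X)\cap\mathrm{Br}(\mathcal R^0(X))$, where $\mathrm{Br}(\mathcal R^0(X))$ is its set of branchings. *)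

theory Defs
  imports
    "HOL-Analysis.Cartesian_Space"
    "HOL-Library.Function_Algebras"
    "HOL-Computational_Algebra.Fraction_Field"
    "HOL-Computational_Algebra.Polynomial"
begin

section \<open>Kac--Moody data\<close>

text \<open>
  A symmetrizable Kac--Moody algebra is given by its generalized Cartan matrix \<open>a\<close>, with a
  symmetrizer \<open>d\<close>, and a realization of \<open>a\<close>.  The index set \<open>I\<close> is the type \<open>'i\<close>.  The weight
  lattice \<open>P\<close> and the coweight lattice, its dual, are free of rank \<open>CARD('r)\<close>; after a choice of
  dual bases both are \<open>int ^ 'r\<close>, with the standard pairing.  The Cartan subalgebra is the
  complexification of the coweight lattice, which is why linear independence and the
  dimension condition are expressed on lattices.
\<close>

record ('i, 'r::finite) datum =
  cartan :: "'i \<Rightarrow> 'i \<Rightarrow> int"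
  symm :: "'i \<Rightarrow> nat"
  root :: "'i \<Rightarrow> int ^ 'r"
  coroot :: "'i \<Rightarrow> int ^ 'r"

definition pairing :: "int ^ 'r \<Rightarrow> int ^ 'r \<Rightarrow> int" where
  "pairing \<mu> h = (\<Sum>k\<in>UNIV. \<mu> $ k * h $ k)"

definition Z_independent :: "('i::finite \<Rightarrow> int ^ 'r::finite) \<Rightarrow> bool" where
  "Z_independent b \<longleftrightarrow> (\<forall>c. (\<Sum>i\<in>UNIV. c i *s b i) = 0 \<longrightarrow> (\<forall>i. c i = 0))"

definition kac_moody_datum :: "('i::finite, 'r::finite) datum \<Rightarrow> bool" where
  "kac_moody_datum D \<longleftrightarrow>
     (\<forall>i. cartan D i i = 2) \<and>
     (\<forall>i j. i \<noteq> j \<longrightarrow> cartan D i j \<le> 0) \<and>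
     (\<forall>i j. cartan D i j = 0 \<longleftrightarrow> cartan D j i = 0) \<and>
     (\<forall>i. symm D i > 0) \<and>
     (\<forall>i j. int (symm D i) * cartan D i j = int (symm D j) * cartan D j i) \<and>
     (\<forall>i j. pairing (root D j) (coroot D i) = cartan D i j) \<and>
     Z_independent (root D) \<and> Z_independent (coroot D) \<and>
     CARD('r) + rank ((\<chi> i j. of_int (cartan D i j)) :: rat ^ 'i ^ 'i) = 2 * CARD('i)"

definition dominant :: "('i, 'r::finite) datum \<Rightarrow> int ^ 'r \<Rightarrow> bool" where
  "dominant D \<Lambda> \<longleftrightarrow> (\<forall>i. pairing \<Lambda> (coroot D i) \<ge> 0)"


section \<open>Normal crystals\<close>

text \<open>The element \<open>0\<close> adjoined to a crystal is represented by \<open>None\<close>.\<close>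

record ('x, 'i, 'r::finite) crystal =
  carr :: "'x set"
  wt :: "'x \<Rightarrow> int ^ 'r"
  eps :: "'i \<Rightarrow> 'x \<Rightarrow> int"
  phi :: "'i \<Rightarrow> 'x \<Rightarrow> int"
  ce :: "'i \<Rightarrow> 'x \<Rightarrow> 'x option"
  cf :: "'i \<Rightarrow> 'x \<Rightarrow> 'x option"

definition iter :: "('x \<Rightarrow> 'x option) \<Rightarrow> nat \<Rightarrow> 'x \<Rightarrow> 'x option" where
  "iter k n x = ((\<lambda>z. Option.bind z k) ^^ n) (Some x)"

definition is_max_iter :: "('x \<Rightarrow> 'x option) \<Rightarrow> 'x \<Rightarrow> int \<Rightarrow> bool" where
  "is_max_iter k x m \<longleftrightarrow>
     (\<exists>n. m = int n \<and> iter k n x \<noteq> None \<and> (\<forall>n'. iter k n' x \<noteq> None \<longrightarrow> n' \<le> n))"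

definition normal_crystal :: "('i, 'r::finite) datum \<Rightarrow> ('x, 'i, 'r::finite) crystal \<Rightarrow> bool" where
  "normal_crystal D \<Gamma> \<longleftrightarrow>
     (\<forall>x \<in> carr \<Gamma>. \<forall>i.
        phi \<Gamma> i x - eps \<Gamma> i x = pairing (wt \<Gamma> x) (coroot D i) \<and>
        is_max_iter (ce \<Gamma> i) x (eps \<Gamma> i x) \<and>
        is_max_iter (cf \<Gamma> i) x (phi \<Gamma> i x) \<and>
        (\<forall>y. ce \<Gamma> i x = Some y \<longrightarrow> y \<in> carr \<Gamma> \<and> wt \<Gamma> y = wt \<Gamma> x + root D i) \<and>
        (\<forall>y. cf \<Gamma> i x = Some y \<longrightarrow> y \<in> carr \<Gamma> \<and> wt \<Gamma> y = wt \<Gamma> x - root D i) \<and>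
        (\<forall>y \<in> carr \<Gamma>. ce \<Gamma> i x = Some y \<longleftrightarrow> cf \<Gamma> i y = Some x))"

definition crystal_morphism ::
  "('x, 'i, 'r::finite) crystal \<Rightarrow> ('y, 'i, 'r::finite) crystal \<Rightarrow> ('x \<Rightarrow> 'y) \<Rightarrow> bool" where
  "crystal_morphism \<Gamma> \<Delta> \<psi> \<longleftrightarrow>
     (\<forall>x \<in> carr \<Gamma>. \<psi> x \<in> carr \<Delta> \<and> wt \<Delta> (\<psi> x) = wt \<Gamma> x \<and>
        (\<forall>i. eps \<Delta> i (\<psi> x) = eps \<Gamma> i x \<and> phi \<Delta> i (\<psi> x) = phi \<Gamma> i x \<and>
             ce \<Delta> i (\<psi> x) = map_option \<psi> (ce \<Gamma> i x) \<and>
             cf \<Delta> i (\<psi> x) = map_option \<psi> (cf \<Gamma> i x)))"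

definition crystal_iso :: "('x, 'i, 'r::finite) crystal \<Rightarrow> ('y, 'i, 'r::finite) crystal \<Rightarrow> bool" where
  "crystal_iso \<Gamma> \<Delta> \<longleftrightarrow> (\<exists>\<psi>. crystal_morphism \<Gamma> \<Delta> \<psi> \<and> bij_betw \<psi> (carr \<Gamma>) (carr \<Delta>))"

definition kashiwara_edges :: "('x, 'i, 'r::finite) crystal \<Rightarrow> ('x \<times> 'x) set" where
  "kashiwara_edges \<Gamma> = {(x, y). x \<in> carr \<Gamma> \<and> (\<exists>i. ce \<Gamma> i x = Some y \<or> cf \<Gamma> i x = Some y)}"

definition component :: "('x, 'i, 'r::finite) crystal \<Rightarrow> 'x \<Rightarrow> ('x, 'i, 'r::finite) crystal" where
  "component \<Gamma> x = \<Gamma>\<lparr>carr := {y. (x, y) \<in> (kashiwara_edges \<Gamma> \<union> (kashiwara_edges \<Gamma>)\<inverse>)\<^sup>*}\<rparr>"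

definition highest :: "('x, 'i, 'r::finite) crystal \<Rightarrow> 'x set" where
  "highest \<Gamma> = {x \<in> carr \<Gamma>. \<forall>i. ce \<Gamma> i x = None}"


section \<open>Quantum groups and their irreducible highest weight modules\<close>

type_synonym ratfun = "rat poly fract"

definition qvar :: ratfun where
  "qvar = Fract [:0, 1:] 1"

definition qi :: "('i, 'r::finite) datum \<Rightarrow> 'i \<Rightarrow> ratfun" where
  "qi D i = qvar ^ symm D i"

definition qint :: "('i, 'r::finite) datum \<Rightarrow> 'i \<Rightarrow> nat \<Rightarrow> ratfun" where
  "qint D i n = (qi D i ^ n - inverse (qi D i) ^ n) / (qi D i - inverse (qi D i))"

definition qfact :: "('i, 'r::finite) datum \<Rightarrow> 'i \<Rightarrow> nat \<Rightarrow> ratfun" where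
  "qfact D i n = (\<Prod>k = 1..n. qint D i k)"

definition qbinom :: "('i, 'r::finite) datum \<Rightarrow> 'i \<Rightarrow> nat \<Rightarrow> nat \<Rightarrow> ratfun" where
  "qbinom D i n k = qfact D i n / (qfact D i k * qfact D i (n - k))"

text \<open>
  Highest weight modules have countable dimension, as they are spanned by the vectors obtained
  by applying words of operators \<open>f\<^sub>i\<close> to a highest weight vector.  So up to isomorphism all of
  them are carried by subspaces of the following space of functions.
\<close>

type_synonym 'i qvec = "'i list \<Rightarrow> ratfun"

definition qscale :: "ratfun \<Rightarrow> 'i qvec \<Rightarrow> 'i qvec" where
  "qscale c x = (\<lambda>w. c * x w)"

definition qsubspace :: "'i qvec set \<Rightarrow> bool" where
  "qsubspace V \<longleftrightarrow> 0 \<in> V \<and> (\<forall>x \<in> V. \<forall>y \<in> V. x + y \<in> V) \<and> (\<forall>c. \<forall>x \<in> V. qscale c x \<in> V)"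

definition qlinear_on :: "'i qvec set \<Rightarrow> ('i qvec \<Rightarrow> 'i qvec) \<Rightarrow> bool" where
  "qlinear_on V T \<longleftrightarrow>
     (\<forall>x \<in> V. T x \<in> V) \<and> (\<forall>x \<in> V. \<forall>y \<in> V. T (x + y) = T x + T y) \<and>
     (\<forall>c. \<forall>x \<in> V. T (qscale c x) = qscale c (T x))"

text \<open>\<open>mq M h\<close> is the action of the generator \<open>q\<^sup>h\<close>, for \<open>h\<close> in the coweight lattice.\<close>

record ('i, 'r::finite) uqmod =
  mcarr :: "'i qvec set"
  mq :: "int ^ 'r \<Rightarrow> 'i qvec \<Rightarrow> 'i qvec"
  me :: "'i \<Rightarrow> 'i qvec \<Rightarrow> 'i qvec"
  mf :: "'i \<Rightarrow> 'i qvec \<Rightarrow> 'i qvec"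

text \<open>\<open>mK D M i\<close> is the action of \<open>q\<close> to the power \<open>d\<^sub>i \<alpha>\<^sub>i\<^sup>\<or>\<close>, and \<open>mKinv D M i\<close> that of its inverse.\<close>

definition mK :: "('i, 'r::finite) datum \<Rightarrow> ('i, 'r::finite) uqmod \<Rightarrow> 'i \<Rightarrow> 'i qvec \<Rightarrow> 'i qvec" where
  "mK D M i = mq M (int (symm D i) *s coroot D i)"

definition mKinv :: "('i, 'r::finite) datum \<Rightarrow> ('i, 'r::finite) uqmod \<Rightarrow> 'i \<Rightarrow> 'i qvec \<Rightarrow> 'i qvec" where
  "mKinv D M i = mq M (- (int (symm D i) *s coroot D i))"

definition serre ::
  "('i, 'r::finite) datum \<Rightarrow> ('i \<Rightarrow> 'i qvec \<Rightarrow> 'i qvec) \<Rightarrow> 'i \<Rightarrow> 'i \<Rightarrow> 'i qvec \<Rightarrow> 'i qvec" where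
  "serre D T i j x =
     (let n = nat (1 - cartan D i j) in
      \<Sum>k\<le>n. qscale ((- 1) ^ k * qbinom D i n k) ((T i ^^ (n - k)) (T j ((T i ^^ k) x))))"

text \<open>
  A module over the quantized enveloping algebra \<open>U\<^sub>q(\<gg>)\<close>, over the field of rational functions in
  \<open>q\<close>: operators satisfying the defining relations.
\<close>

definition uq_module :: "('i, 'r::finite) datum \<Rightarrow> ('i, 'r::finite) uqmod \<Rightarrow> bool" where
  "uq_module D M \<longleftrightarrow>
     qsubspace (mcarr M) \<and>
     (\<forall>h. qlinear_on (mcarr M) (mq M h)) \<and>
     (\<forall>i. qlinear_on (mcarr M) (me M i)) \<and>
     (\<forall>i. qlinear_on (mcarr M) (mf M i)) \<and>
     (\<forall>x \<in> mcarr M.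
        mq M 0 x = x \<and>
        (\<forall>h h'. mq M (h + h') x = mq M h (mq M h' x)) \<and>
        (\<forall>h i. mq M h (me M i x) = qscale (qvar powi pairing (root D i) h) (me M i (mq M h x))) \<and>
        (\<forall>h i. mq M h (mf M i x) = qscale (qvar powi (- pairing (root D i) h)) (mf M i (mq M h x))) \<and>
        (\<forall>i j. me M i (mf M j x) - mf M j (me M i x) =
           (if i = j then qscale (inverse (qi D i - inverse (qi D i))) (mK D M i x - mKinv D M i x)
            else 0)) \<and>
        (\<forall>i j. i \<noteq> j \<longrightarrow> serre D (me M) i j x = 0 \<and> serre D (mf M) i j x = 0))"

definition wspace :: "('i, 'r::finite) uqmod \<Rightarrow> int ^ 'r \<Rightarrow> 'i qvec set" where
  "wspace M \<mu> = {x \<in> mcarr M. \<forall>h. mq M h x = qscale (qvar powi pairing \<mu> h) x}"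

definition uq_submodule :: "('i, 'r::finite) uqmod \<Rightarrow> 'i qvec set \<Rightarrow> bool" where
  "uq_submodule M W \<longleftrightarrow>
     W \<subseteq> mcarr M \<and> qsubspace W \<and>
     (\<forall>x \<in> W. (\<forall>h. mq M h x \<in> W) \<and> (\<forall>i. me M i x \<in> W \<and> mf M i x \<in> W))"

definition irreducible_module :: "('i, 'r::finite) uqmod \<Rightarrow> bool" where
  "irreducible_module M \<longleftrightarrow>
     mcarr M \<noteq> {0} \<and> (\<forall>W. uq_submodule M W \<longrightarrow> W = {0} \<or> W = mcarr M)"

definition highest_weight_vector :: "('i, 'r::finite) uqmod \<Rightarrow> int ^ 'r \<Rightarrow> 'i qvec \<Rightarrow> bool" where
  "highest_weight_vector M \<Lambda> v \<longleftrightarrow> v \<in> wspace M \<Lambda> \<and> v \<noteq> 0 \<and> (\<forall>i. me M i v = 0)"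

definition highest_weight_module ::
  "('i, 'r::finite) datum \<Rightarrow> ('i, 'r::finite) uqmod \<Rightarrow> int ^ 'r \<Rightarrow> 'i qvec \<Rightarrow> bool" where
  "highest_weight_module D M \<Lambda> v \<longleftrightarrow>
     uq_module D M \<and> highest_weight_vector M \<Lambda> v \<and>
     (\<forall>W. uq_submodule M W \<and> v \<in> W \<longrightarrow> W = mcarr M)"


section \<open>The crystal of an irreducible highest weight module\<close>

definition dpow :: "('i, 'r::finite) datum \<Rightarrow> ('i, 'r::finite) uqmod \<Rightarrow> 'i \<Rightarrow> nat \<Rightarrow> 'i qvec \<Rightarrow> 'i qvec" where
  "dpow D M i n x = qscale (inverse (qfact D i n)) ((mf M i ^^ n) x)"

text \<open>
  The decomposition \<open>x = \<Sum>\<^sub>k f\<^sub>i\<^sup>(\<^sup>k\<^sup>) u\<^sub>k\<close> of a vector \<open>x\<close> of weight \<open>\<mu>\<close> along \<open>i\<close>-strings.  The last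
  condition on \<open>u\<^sub>k\<close> says that \<open>f\<^sub>i\<^sup>(\<^sup>k\<^sup>) u\<^sub>k\<close> does not vanish unless \<open>u\<^sub>k = 0\<close>; it makes the
  decomposition unique.
\<close>

definition string_decomposition ::
  "('i, 'r::finite) datum \<Rightarrow> ('i, 'r::finite) uqmod \<Rightarrow> 'i \<Rightarrow> int ^ 'r \<Rightarrow> 'i qvec \<Rightarrow> nat \<Rightarrow> (nat \<Rightarrow> 'i qvec) \<Rightarrow> bool"
  where
  "string_decomposition D M i \<mu> x N u \<longleftrightarrow>
     x \<in> wspace M \<mu> \<and>
     (\<forall>k\<le>N. u k \<in> wspace M (\<mu> + int k *s root D i) \<and> me M i (u k) = 0 \<and>
             (u k \<noteq> 0 \<longrightarrow> pairing \<mu> (coroot D i) + int k \<ge> 0)) \<and>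
     x = (\<Sum>k\<le>N. dpow D M i k (u k))"

text \<open>The Kashiwara operators on weight vectors of the module, given by their graphs.\<close>

definition kash_e :: "('i, 'r::finite) datum \<Rightarrow> ('i, 'r::finite) uqmod \<Rightarrow> 'i \<Rightarrow> 'i qvec \<Rightarrow> 'i qvec \<Rightarrow> bool" where
  "kash_e D M i x y \<longleftrightarrow>
     (\<exists>\<mu> N u. string_decomposition D M i \<mu> x N u \<and> y = (\<Sum>k = 1..N. dpow D M i (k - 1) (u k)))"

definition kash_f :: "('i, 'r::finite) datum \<Rightarrow> ('i, 'r::finite) uqmod \<Rightarrow> 'i \<Rightarrow> 'i qvec \<Rightarrow> 'i qvec \<Rightarrow> bool" where
  "kash_f D M i x y \<longleftrightarrow>
     (\<exists>\<mu> N u. string_decomposition D M i \<mu> x N u \<and> y = (\<Sum>k\<le>N. dpow D M i (k + 1) (u k)))"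

inductive_set kash_words :: "('i, 'r::finite) datum \<Rightarrow> ('i, 'r::finite) uqmod \<Rightarrow> 'i qvec \<Rightarrow> 'i qvec set"
  for D :: "('i, 'r::finite) datum" and M :: "('i, 'r::finite) uqmod" and v :: "'i qvec" where
  base: "v \<in> kash_words D M v"
| step: "x \<in> kash_words D M v \<Longrightarrow> kash_f D M i x y \<Longrightarrow> y \<in> kash_words D M v"

definition regular_at_0 :: "ratfun set" where
  "regular_at_0 = {Fract a b | a b. poly b 0 \<noteq> 0}"

definition lattice :: "('i, 'r::finite) datum \<Rightarrow> ('i, 'r::finite) uqmod \<Rightarrow> 'i qvec \<Rightarrow> 'i qvec set" where
  "lattice D M v =
     {\<Sum>x\<in>S. qscale (c x) x | S c. finite S \<and> S \<subseteq> kash_words D M v \<and> c ` S \<subseteq> regular_at_0}"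

definition residue_class :: "('i, 'r::finite) datum \<Rightarrow> ('i, 'r::finite) uqmod \<Rightarrow> 'i qvec \<Rightarrow> 'i qvec \<Rightarrow> 'i qvec set" where
  "residue_class D M v x = {x + qscale qvar z | z. z \<in> lattice D M v}"

definition crystal_basis :: "('i, 'r::finite) datum \<Rightarrow> ('i, 'r::finite) uqmod \<Rightarrow> 'i qvec \<Rightarrow> 'i qvec set set" where
  "crystal_basis D M v = residue_class D M v ` kash_words D M v - {residue_class D M v 0}"

definition induced_rel ::
  "('i, 'r::finite) datum \<Rightarrow> ('i, 'r::finite) uqmod \<Rightarrow> 'i qvec \<Rightarrow> ('i qvec \<Rightarrow> 'i qvec \<Rightarrow> bool) \<Rightarrow>
   'i qvec set \<Rightarrow> 'i qvec set \<Rightarrow> bool" where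
  "induced_rel D M v K b b' \<longleftrightarrow>
     b' \<in> crystal_basis D M v \<and>
     (\<exists>x \<in> lattice D M v. \<exists>y. b = residue_class D M v x \<and> K x y \<and> b' = residue_class D M v y)"

definition induced ::
  "('i, 'r::finite) datum \<Rightarrow> ('i, 'r::finite) uqmod \<Rightarrow> 'i qvec \<Rightarrow> ('i qvec \<Rightarrow> 'i qvec \<Rightarrow> bool) \<Rightarrow>
   'i qvec set \<Rightarrow> 'i qvec set option" where
  "induced D M v K b =
     (if \<exists>b'. induced_rel D M v K b b' then Some (SOME b'. induced_rel D M v K b b') else None)"

text \<open>
  Kashiwara's crystal \<open>B(\<Lambda>)\<close> of the irreducible module \<open>M\<close> with highest weight vector \<open>v\<close> of weight
  \<open>\<Lambda>\<close>.  By Kashiwara's theorem, the values chosen below do not depend on the choices, and the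
  maxima are attained.
\<close>

definition crystal_B ::
  "('i, 'r::finite) datum \<Rightarrow> ('i, 'r::finite) uqmod \<Rightarrow> 'i qvec \<Rightarrow> ('i qvec set, 'i, 'r::finite) crystal" where
  "crystal_B D M v =
     (let e = (\<lambda>i. induced D M v (kash_e D M i)); f = (\<lambda>i. induced D M v (kash_f D M i)) in
      \<lparr>carr = crystal_basis D M v,
       wt = (\<lambda>b. SOME \<mu>. b \<inter> wspace M \<mu> \<noteq> {}),
       eps = (\<lambda>i b. int (GREATEST n. iter (e i) n b \<noteq> None)),
       phi = (\<lambda>i b. int (GREATEST n. iter (f i) n b \<noteq> None)),
       ce = e,
       cf = f\<rparr>)"

definition is_crystal :: "('i, 'r::finite) datum \<Rightarrow> ('x, 'i, 'r::finite) crystal \<Rightarrow> bool" where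
  "is_crystal D \<Gamma> \<longleftrightarrow>
     normal_crystal D \<Gamma> \<and>
     (\<forall>x \<in> carr \<Gamma>. \<exists>\<Lambda> M v.
        dominant D \<Lambda> \<and> highest_weight_module D M \<Lambda> v \<and> irreducible_module M \<and>
        crystal_iso (component \<Gamma> x) (crystal_B D M v))"


section \<open>The free monoid on a crystal\<close>

text \<open>
  The word \<open>x # w\<close> is \<open>x \<otimes> w\<close>.  The formulas for \<open>eps\<close> and \<open>phi\<close> of a tensor product are those forced
  by normality: \<open>e\<^sub>i\<close> acts on the right factor until its \<open>eps\<close> has dropped to \<open>phi\<close> of the left
  factor, and on the left factor from then on; dually for \<open>f\<^sub>i\<close>.
\<close>

primrec word_eps :: "('x, 'i, 'r::finite) crystal \<Rightarrow> 'i \<Rightarrow> 'x list \<Rightarrow> int" where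
  "word_eps \<Gamma> i [] = 0"
| "word_eps \<Gamma> i (x # w) = eps \<Gamma> i x + max 0 (word_eps \<Gamma> i w - phi \<Gamma> i x)"

primrec word_phi :: "('x, 'i, 'r::finite) crystal \<Rightarrow> 'i \<Rightarrow> 'x list \<Rightarrow> int" where
  "word_phi \<Gamma> i [] = 0"
| "word_phi \<Gamma> i (x # w) = word_phi \<Gamma> i w + max 0 (phi \<Gamma> i x - word_eps \<Gamma> i w)"

primrec word_e :: "('x, 'i, 'r::finite) crystal \<Rightarrow> 'i \<Rightarrow> 'x list \<Rightarrow> 'x list option" where
  "word_e \<Gamma> i [] = None"
| "word_e \<Gamma> i (x # w) =
     (if phi \<Gamma> i x \<ge> word_eps \<Gamma> i w then map_option (\<lambda>y. y # w) (ce \<Gamma> i x)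
      else map_option (\<lambda>w'. x # w') (word_e \<Gamma> i w))"

primrec word_f :: "('x, 'i, 'r::finite) crystal \<Rightarrow> 'i \<Rightarrow> 'x list \<Rightarrow> 'x list option" where
  "word_f \<Gamma> i [] = None"
| "word_f \<Gamma> i (x # w) =
     (if phi \<Gamma> i x > word_eps \<Gamma> i w then map_option (\<lambda>y. y # w) (cf \<Gamma> i x)
      else map_option (\<lambda>w'. x # w') (word_f \<Gamma> i w))"

definition free_monoid :: "('x, 'i, 'r::finite) crystal \<Rightarrow> ('x list, 'i, 'r::finite) crystal" where
  "free_monoid \<Gamma> =
     \<lparr>carr = lists (carr \<Gamma>), wt = (\<lambda>w. sum_list (map (wt \<Gamma>) w)),
      eps = word_eps \<Gamma>, phi = word_phi \<Gamma>, ce = word_e \<Gamma>, cf = word_f \<Gamma>\<rparr>"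


section \<open>Crystal 2-polygraphs\<close>

record ('a, 'b, 'i, 'r::finite) polygraph =
  gen1 :: "('a, 'i, 'r::finite) crystal"
  gen2 :: "('b, 'i, 'r::finite) crystal"
  src :: "'b \<Rightarrow> 'a list"
  tgt :: "'b \<Rightarrow> 'a list"

definition crystal_2polygraph :: "('i, 'r::finite) datum \<Rightarrow> ('a, 'b, 'i, 'r::finite) polygraph \<Rightarrow> bool" where
  "crystal_2polygraph D X \<longleftrightarrow>
     is_crystal D (gen1 X) \<and> is_crystal D (gen2 X) \<and>
     crystal_morphism (gen2 X) (free_monoid (gen1 X)) (src X) \<and>
     crystal_morphism (gen2 X) (free_monoid (gen1 X)) (tgt X)"

definition words :: "('a, 'b, 'i, 'r::finite) polygraph \<Rightarrow> 'a list set" where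
  "words X = carr (free_monoid (gen1 X))"

text \<open>The triple \<open>(t, \<alpha>, v)\<close> is the rewriting step \<open>t\<alpha>v\<close>.\<close>

type_synonym ('a, 'b) rstep = "'a list \<times> 'b \<times> 'a list"

fun step_src :: "('a, 'b, 'i, 'r::finite) polygraph \<Rightarrow> ('a, 'b) rstep \<Rightarrow> 'a list" where
  "step_src X (t, \<alpha>, v) = t @ src X \<alpha> @ v"

fun step_tgt :: "('a, 'b, 'i, 'r::finite) polygraph \<Rightarrow> ('a, 'b) rstep \<Rightarrow> 'a list" where
  "step_tgt X (t, \<alpha>, v) = t @ tgt X \<alpha> @ v"

text \<open>
  Given the actions \<open>kw\<close> on words and \<open>kg\<close> on 2-generators of a Kashiwara operator, its action on
  steps.  The last case covers \<open>kw (t @ src X \<alpha> @ v) = None\<close>.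
\<close>

fun step_op ::
  "('a, 'b, 'i, 'r::finite) polygraph \<Rightarrow> ('a list \<Rightarrow> 'a list option) \<Rightarrow> ('b \<Rightarrow> 'b option) \<Rightarrow>
   ('a, 'b) rstep \<Rightarrow> ('a, 'b) rstep option" where
  "step_op X kw kg (t, \<alpha>, v) =
     (let w = kw (t @ src X \<alpha> @ v) in
      if kw t \<noteq> None \<and> w = Some (the (kw t) @ src X \<alpha> @ v)
        then Some (the (kw t), \<alpha>, v)
      else if kg \<alpha> \<noteq> None \<and> kw (src X \<alpha>) \<noteq> None \<and> w = Some (t @ the (kw (src X \<alpha>)) @ v)
        then Some (t, the (kg \<alpha>), v)
      else if kw v \<noteq> None \<and> w = Some (t @ src X \<alpha> @ the (kw v))
        then Some (t, \<alpha>, the (kw v))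
      else None)"

definition step_crystal :: "('a, 'b, 'i, 'r::finite) polygraph \<Rightarrow> (('a, 'b) rstep, 'i, 'r::finite) crystal" where
  "step_crystal X =
     (let W = free_monoid (gen1 X) in
      \<lparr>carr = {(t, \<alpha>, v). t \<in> words X \<and> \<alpha> \<in> carr (gen2 X) \<and> v \<in> words X},
       wt = (\<lambda>\<gamma>. wt W (step_src X \<gamma>)),
       eps = (\<lambda>i \<gamma>. eps W i (step_src X \<gamma>)),
       phi = (\<lambda>i \<gamma>. phi W i (step_src X \<gamma>)),
       ce = (\<lambda>i. step_op X (ce W i) (ce (gen2 X) i)),
       cf = (\<lambda>i. step_op X (cf W i) (cf (gen2 X) i))\<rparr>)"


section \<open>Abstract rewriting systems\<close>

record ('o, 's) ars =
  objs :: "'o set"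
  rsteps :: "'s set"
  rsrc :: "'s \<Rightarrow> 'o"
  rtgt :: "'s \<Rightarrow> 'o"

primrec rewriting_seq :: "('o, 's) ars \<Rightarrow> 'o \<Rightarrow> 's list \<Rightarrow> 'o \<Rightarrow> bool" where
  "rewriting_seq A x [] y \<longleftrightarrow> x \<in> objs A \<and> x = y"
| "rewriting_seq A x (\<gamma> # p) y \<longleftrightarrow>
     \<gamma> \<in> rsteps A \<and> x \<in> objs A \<and> rsrc A \<gamma> = x \<and> rewriting_seq A (rtgt A \<gamma>) p y"

definition joinable :: "('o, 's) ars \<Rightarrow> 'o \<Rightarrow> 'o \<Rightarrow> bool" where
  "joinable A y z \<longleftrightarrow> (\<exists>p q w. rewriting_seq A y p w \<and> rewriting_seq A z q w)"

definition local_branchings :: "('o, 's) ars \<Rightarrow> ('s \<times> 's) set" where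
  "local_branchings A = {(\<gamma>, \<delta>). \<gamma> \<in> rsteps A \<and> \<delta> \<in> rsteps A \<and> rsrc A \<gamma> = rsrc A \<delta>}"

definition confluent_local_branching :: "('o, 's) ars \<Rightarrow> 's \<times> 's \<Rightarrow> bool" where
  "confluent_local_branching A b \<longleftrightarrow> joinable A (rtgt A (fst b)) (rtgt A (snd b))"

definition terminating :: "('o, 's) ars \<Rightarrow> bool" where
  "terminating A \<longleftrightarrow>
     \<not> (\<exists>\<gamma> :: nat \<Rightarrow> 's. \<forall>n. \<gamma> n \<in> rsteps A \<and> rtgt A (\<gamma> n) = rsrc A (\<gamma> (Suc n)))"

definition confluent :: "('o, 's) ars \<Rightarrow> bool" where
  "confluent A \<longleftrightarrow>
     (\<forall>x p q y z. rewriting_seq A x p y \<and> rewriting_seq A x q z \<longrightarrow> joinable A y z)"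

definition locally_confluent :: "('o, 's) ars \<Rightarrow> bool" where
  "locally_confluent A \<longleftrightarrow> (\<forall>b \<in> local_branchings A. confluent_local_branching A b)"

definition rewriting :: "('a, 'b, 'i, 'r::finite) polygraph \<Rightarrow> ('a list, ('a, 'b) rstep) ars" where
  "rewriting X =
     \<lparr>objs = words X, rsteps = carr (step_crystal X), rsrc = step_src X, rtgt = step_tgt X\<rparr>"

definition rewriting_hw :: "('a, 'b, 'i, 'r::finite) polygraph \<Rightarrow> ('a list, ('a, 'b) rstep) ars" where
  "rewriting_hw X =
     \<lparr>objs = highest (free_monoid (gen1 X)), rsteps = highest (step_crystal X),
      rsrc = step_src X, rtgt = step_tgt X\<rparr>"


section \<open>Critical branchings\<close>

fun whisker :: "'a list \<Rightarrow> ('a, 'b) rstep \<Rightarrow> 'a list \<Rightarrow> ('a, 'b) rstep" where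
  "whisker u (t, \<alpha>, v) u' = (u @ t, \<alpha>, v @ u')"

definition aspherical :: "('a, 'b) rstep \<times> ('a, 'b) rstep \<Rightarrow> bool" where
  "aspherical b \<longleftrightarrow> fst b = snd b"

definition peiffer ::
  "('a, 'b, 'i, 'r::finite) polygraph \<Rightarrow> ('a, 'b) rstep \<times> ('a, 'b) rstep \<Rightarrow> bool" where
  "peiffer X b \<longleftrightarrow>
     (\<exists>\<gamma> \<in> carr (step_crystal X). \<exists>\<delta> \<in> carr (step_crystal X).
        let l = whisker [] \<gamma> (step_src X \<delta>); r = whisker (step_src X \<gamma>) \<delta> []
        in b = (l, r) \<or> b = (r, l))"

definition overlapping_branchings ::
  "('a, 'b, 'i, 'r::finite) polygraph \<Rightarrow> (('a, 'b) rstep \<times> ('a, 'b) rstep) set" where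
  "overlapping_branchings X =
     {b \<in> local_branchings (rewriting X). \<not> aspherical b \<and> \<not> peiffer X b}"

text \<open>The generating relation is already reflexive and transitive.\<close>

definition branching_le ::
  "('a, 'b, 'i, 'r::finite) polygraph \<Rightarrow> ('a, 'b) rstep \<times> ('a, 'b) rstep \<Rightarrow>
   ('a, 'b) rstep \<times> ('a, 'b) rstep \<Rightarrow> bool" where
  "branching_le X b c \<longleftrightarrow>
     (\<exists>u \<in> words X. \<exists>v \<in> words X. c = (whisker u (fst b) v, whisker u (snd b) v))"

definition critical_branchings ::
  "('a, 'b, 'i, 'r::finite) polygraph \<Rightarrow> (('a, 'b) rstep \<times> ('a, 'b) rstep) set" where
  "critical_branchings X =
     {c \<in> overlapping_branchings X.
        \<forall>b \<in> local_branchings (rewriting X). branching_le X b c \<longrightarrow> b = c}"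

text \<open>
  Critical branchings are pairs of steps, so those among them that are branchings of the highest
  weight system are local branchings of it.
\<close>

definition critical_branchings_hw ::
  "('a, 'b, 'i, 'r::finite) polygraph \<Rightarrow> (('a, 'b) rstep \<times> ('a, 'b) rstep) set" where
  "critical_branchings_hw X = critical_branchings X \<inter> local_branchings (rewriting_hw X)"

end

theory Submission
  imports Defs
begin

text \<open>
  The weights of a highest weight module of highest weight \<open>\<Lambda>\<close> lie in \<open>\<Lambda> - Q\<^sup>+\<close>, and each \<open>e\<^sub>i\<close> adds
  a simple root; as the simple roots are independent, every sequence of operators \<open>e\<^sub>i\<close> applied to
  a letter, hence to a word, terminates, and so ends at a highest weight word.

  Since source and target are crystal morphisms, \<open>e\<^sub>i\<close> and \<open>f\<^sub>i\<close> transport rewriting steps whenever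
  they do not annihilate the source.  By induction along the \<open>e\<^sub>i\<close>, an infinite rewriting sequence
  or a branching is moved to highest weight, and a confluence found there is moved back by the
  \<open>f\<^sub>i\<close>; Newman's lemma then gives (i).

  For (ii), a factor of a highest weight word need not be of highest weight, so one first reduces
  an arbitrary local branching to a critical one and only then moves to highest weight.
  This is possible because \<open>e\<^sub>i\<close> preserves criticality, which for distinct steps with a common
  source depends only on the lengths of their parts.
\<close>

section \<open>Weights of highest weight modules\<close>

text \<open>The translated cone \<open>\<Lambda> - Q\<^sup>+\<close>. The coefficients are natural
  numbers so that their sum can later measure how often a weight may still be raised.\<close>

definition root_cone :: "('i::finite, 'r::finite) datum \<Rightarrow> int ^ 'r \<Rightarrow> (int ^ 'r) set" where
  "root_cone D \<Lambda> = {\<Lambda> - (\<Sum>i\<in>UNIV. int (c i) *s root D i) | c. True}"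

lemma root_cone_self: "\<Lambda> \<in> root_cone D \<Lambda>"
  unfolding root_cone_def by (auto intro!: exI[of _ "\<lambda>_. 0"])

lemma root_cone_minus_root:
  fixes D :: "('i::finite, 'r::finite) datum"
  assumes "\<mu> \<in> root_cone D \<Lambda>"
  shows "\<mu> - root D i \<in> root_cone D \<Lambda>"
proof -
  obtain c :: "'i \<Rightarrow> nat" where c: "\<mu> = \<Lambda> - (\<Sum>j\<in>UNIV. int (c j) *s root D j)"
    using assms unfolding root_cone_def by auto
  have "(\<Sum>j\<in>UNIV. int ((c(i := Suc (c i))) j) *s root D j)
      = (\<Sum>j\<in>UNIV. int (c j) *s root D j + (if j = i then root D i else 0))"
    by (intro sum.cong) (auto simp: vec_eq_iff algebra_simps)
  also have "\<dots> = (\<Sum>j\<in>UNIV. int (c j) *s root D j) + root D i"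
    by (simp add: sum.distrib)
  finally show ?thesis
    unfolding root_cone_def c by (auto intro!: exI[of _ "c(i := Suc (c i))"])
qed

section \<open>Powers of \<open>q\<close>, scalars and the pairing\<close>

lemma qvar_power: "qvar ^ n = Fract (monom 1 n) 1"
  by (induction n) (auto simp: qvar_def One_fract_def monom_Suc monom_0 one_pCons)

lemma qvar_nonzero: "qvar \<noteq> 0"
  by (simp add: qvar_def Zero_fract_def eq_fract)

text \<open>A positive power of \<open>q\<close> is a monomial of positive degree, and negative
  exponents reduce to positive ones by inversion. So \<open>q\<close> is not a root of unity, and
  distinct exponents give distinct eigenvalues.\<close>

lemma qvar_powi_eq_1: "qvar powi n = 1 \<Longrightarrow> n = 0"
proof -
  have pos: "m = 0" if "qvar ^ m = 1" for m
  proof (rule ccontr)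
    assume "m \<noteq> 0"
    have "monom (1::rat) m = 1"
      using that by (simp add: qvar_power One_fract_def eq_fract)
    then have "degree (monom (1::rat) m) = 0" by simp
    with \<open>m \<noteq> 0\<close> show False by (simp add: degree_monom_eq)
  qed
  assume "qvar powi n = 1"
  then show ?thesis
    using pos[of "nat n"] pos[of "nat (- n)"]
    by (cases "n \<ge> 0") (auto simp: power_int_def power_inverse split: if_splits)
qed

lemma qvar_powi_inj: "qvar powi m = qvar powi n \<Longrightarrow> m = n"
proof -
  assume "qvar powi m = qvar powi n"
  then have "qvar powi (m - n) = 1"
    by (simp add: power_int_diff qvar_nonzero)
  then show ?thesis using qvar_powi_eq_1[of "m - n"] by simp
qed

lemma qscale_simps:
  "qscale a (qscale b x) = qscale (a * b) x" "qscale a (x + y) = qscale a x + qscale a y"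
  "qscale (a + b) x = qscale a x + qscale b x" "qscale 1 x = x" "qscale 0 x = 0" "qscale a 0 = 0"
  "qscale (a - b) x = qscale a x - qscale b x" "qscale a (x - y) = qscale a x - qscale a y"
  by (auto simp: qscale_def fun_eq_iff algebra_simps)

lemma qscale_eq_0: "qscale a x = 0 \<Longrightarrow> a \<noteq> 0 \<Longrightarrow> x = 0"
  by (auto simp: qscale_def fun_eq_iff)

lemma diff_eq_plus_qscale: "x - y = x + qscale (- 1) (y :: 'i qvec)"
  by (auto simp: qscale_def fun_eq_iff)

lemma qsubspace_diff: "qsubspace V \<Longrightarrow> x \<in> V \<Longrightarrow> y \<in> V \<Longrightarrow> x - y \<in> V"
  unfolding qsubspace_def diff_eq_plus_qscale by blast

lemma qsubspace_sum_list: "qsubspace V \<Longrightarrow> set xs \<subseteq> V \<Longrightarrow> sum_list xs \<in> V"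
proof (induction xs)
  case Nil then show ?case by (simp only: qsubspace_def sum_list.Nil)
next
  case (Cons x xs)
  then have "x \<in> V" "sum_list xs \<in> V" by simp_all
  with Cons.prems(1) show ?case unfolding sum_list.Cons qsubspace_def by blast
qed

lemma qsubspace_sum: "qsubspace V \<Longrightarrow> (\<And>k. k \<in> S \<Longrightarrow> g k \<in> V) \<Longrightarrow> sum g S \<in> V"
proof (induction S rule: infinite_finite_induct)
  case (insert k S)
  then have "g k \<in> V" "sum g S \<in> V" by simp_all
  with insert show ?case unfolding sum.insert[OF insert.hyps] qsubspace_def by blast
qed (simp_all only: sum.infinite sum.empty qsubspace_def simp_thms)

lemma pairing_simps:
  "pairing (\<mu> + \<nu>) h = pairing \<mu> h + pairing \<nu> h" "pairing (\<mu> - \<nu>) h = pairing \<mu> h - pairing \<nu> h"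
  by (simp_all add: pairing_def algebra_simps sum.distrib sum_subtractf)

lemma pairing_separates:
  assumes "\<mu> \<noteq> \<nu>"
  obtains h where "pairing \<mu> h \<noteq> pairing \<nu> h"
proof -
  obtain k where k: "\<mu> $ k \<noteq> \<nu> $ k" using assms by (auto simp: vec_eq_iff)
  \<comment> \<open>The separating coweight is a standard basis vector: it reads off a coordinate in
    which the weights differ.\<close>
  have "pairing \<kappa> (axis k 1) = \<kappa> $ k" for \<kappa>
    unfolding pairing_def by (simp add: axis_def if_distrib cong: if_cong)
  with k that show ?thesis by metis
qed

section \<open>Linear operators, weight spaces and the span under the lowering operators\<close>

lemma qlinear_on_diff:
  assumes "qsubspace V" "qlinear_on V T" "x \<in> V" "y \<in> V"
  shows "T (x - y) = T x - T y"
  using assms unfolding diff_eq_plus_qscale qlinear_on_def qsubspace_def by metis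

lemma qlinear_on_zero: "qsubspace V \<Longrightarrow> qlinear_on V T \<Longrightarrow> T 0 = 0"
  using qlinear_on_diff[of V T 0 0] by (auto simp: qsubspace_def)

lemma qlinear_on_sum_list:
  assumes "qsubspace V" "qlinear_on V T" "set xs \<subseteq> V"
  shows "T (sum_list xs) = sum_list (map T xs)"
  using assms(3)
proof (induction xs)
  case Nil
  show ?case using qlinear_on_zero[OF assms(1,2)] by (simp only: sum_list.Nil list.map)
next
  case (Cons x xs)
  then have "T (x + sum_list xs) = T x + T (sum_list xs)"
    using assms qsubspace_sum_list[of V xs] by (simp add: qlinear_on_def)
  with Cons show ?case by (simp only: sum_list.Cons list.map set_simps insert_subset)
qed

text \<open>Stability under \<open>e\<^sub>i\<close> and \<open>q\<^sup>h\<close> is not built in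
  but derived, so that weights can be followed by an induction in which only the
  \<open>f\<^sub>i\<close> occur.\<close>

inductive_set f_span :: "('i, 'r::finite) uqmod \<Rightarrow> 'i qvec \<Rightarrow> 'i qvec set" for M v where
  "v \<in> f_span M v"
| "x \<in> f_span M v \<Longrightarrow> mf M i x \<in> f_span M v"
| "x \<in> f_span M v \<Longrightarrow> y \<in> f_span M v \<Longrightarrow> x + y \<in> f_span M v"
| "x \<in> f_span M v \<Longrightarrow> qscale c x \<in> f_span M v"

context
  fixes D :: "('i::finite, 'r::finite) datum" and M :: "('i, 'r) uqmod"
  assumes M: "uq_module D M"
begin

lemma mcarr_subspace: "qsubspace (mcarr M)"
  and mq_linear: "qlinear_on (mcarr M) (mq M h)"
  and me_linear: "qlinear_on (mcarr M) (me M i)"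
  and mf_linear: "qlinear_on (mcarr M) (mf M i)"
  and mq_mf: "x \<in> mcarr M \<Longrightarrow>
        mq M h (mf M i x) = qscale (qvar powi (- pairing (root D i) h)) (mf M i (mq M h x))"
  and me_mf: "x \<in> mcarr M \<Longrightarrow> me M i (mf M j x) - mf M j (me M i x) =
           (if i = j then qscale (inverse (qi D i - inverse (qi D i))) (mK D M i x - mKinv D M i x)
            else 0)"
  using M unfolding uq_module_def by blast+

lemma wspace_subset: "wspace M \<mu> \<subseteq> mcarr M"
  by (auto simp: wspace_def)

lemma wspace_subspace: "qsubspace (wspace M \<mu>)"
  using mcarr_subspace mq_linear qlinear_on_zero[OF mcarr_subspace mq_linear]
  unfolding qsubspace_def wspace_def qlinear_on_def
  by (auto simp: qscale_simps mult.commute)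

lemma mf_wspace: "x \<in> wspace M \<mu> \<Longrightarrow> mf M i x \<in> wspace M (\<mu> - root D i)"
proof -
  assume x: "x \<in> wspace M \<mu>"
  then have x': "x \<in> mcarr M" "\<And>h. mq M h x = qscale (qvar powi pairing \<mu> h) x"
    by (auto simp: wspace_def)
  have "mq M h (mf M i x) = qscale (qvar powi pairing (\<mu> - root D i) h) (mf M i x)" for h
  proof -
    have "mf M i (mq M h x) = qscale (qvar powi pairing \<mu> h) (mf M i x)"
      using mf_linear[of i] x' by (simp add: qlinear_on_def)
    then have "mq M h (mf M i x) =
        qscale (qvar powi (- pairing (root D i) h) * qvar powi pairing \<mu> h) (mf M i x)"
      by (simp only: mq_mf[OF x'(1)] qscale_simps)
    also have "qvar powi (- pairing (root D i) h) * qvar powi pairing \<mu> h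
        = qvar powi pairing (\<mu> - root D i) h"
      by (simp add: pairing_simps qvar_nonzero flip: power_int_add)
    finally show ?thesis .
  qed
  then show ?thesis using mf_linear[of i] x'(1) by (simp add: wspace_def qlinear_on_def)
qed

lemma mq_wspace: "x \<in> wspace M \<mu> \<Longrightarrow> mq M h x \<in> wspace M \<mu>"
  using wspace_subspace[of \<mu>] unfolding qsubspace_def by (simp add: wspace_def)

text \<open>Independence of weight spaces, by elimination: one summand is killed while
  \<open>x\<close> is multiplied by a nonzero scalar and the other summands keep their
  weights.\<close>

lemma weight_vector_sum_zero:
  assumes "x \<in> wspace M \<mu>" "x = sum_list xs" "\<forall>y \<in> set xs. \<exists>\<nu>. \<nu> \<noteq> \<mu> \<and> y \<in> wspace M \<nu>"
  shows "x = 0"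
  using assms
proof (induction xs arbitrary: x rule: length_induct)
  case (1 xs)
  show ?case
  proof (cases xs)
    case Nil with 1 show ?thesis by simp
  next
    case (Cons y ys)
    obtain \<nu> where \<nu>: "\<nu> \<noteq> \<mu>" "y \<in> wspace M \<nu>" using 1 Cons by auto
    obtain h where h: "pairing \<mu> h \<noteq> pairing \<nu> h" using pairing_separates \<nu>(1) by metis
    \<comment> \<open>Subtracting the eigenvalue of \<open>mq M h\<close> at weight
      \<open>\<nu>\<close> gives an operator that kills \<open>y\<close> and acts on
      \<open>x\<close> by the scalar \<open>?c\<close>, nonzero by the choice of
      \<open>h\<close>.\<close>
    define T where "T z = mq M h z - qscale (qvar powi pairing \<nu> h) z" for z
    have T_wspace: "T z \<in> wspace M \<kappa>" if "z \<in> wspace M \<kappa>" for z \<kappa>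
      unfolding T_def using that mq_wspace wspace_subspace
      by (intro qsubspace_diff) (auto simp: qsubspace_def)
    have T_lin: "qlinear_on (mcarr M) T"
      using mq_linear[of h] mcarr_subspace qsubspace_diff[OF mcarr_subspace]
      unfolding T_def qlinear_on_def qsubspace_def
      by (auto simp: qscale_simps algebra_simps)
    have sub: "set xs \<subseteq> mcarr M" using 1 wspace_subset by blast
    let ?c = "qvar powi pairing \<mu> h - qvar powi pairing \<nu> h"
    have c: "?c \<noteq> 0" using h qvar_powi_inj by auto
    have Tx: "T x = qscale ?c x"
      using 1 by (auto simp: T_def wspace_def qscale_simps)
    have "T y = 0" using \<nu> by (auto simp: T_def wspace_def)
    then have "sum_list (map T xs) = sum_list (map T ys)"
      by (simp only: Cons list.map sum_list.Cons add_0_left)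
    then have "T x = sum_list (map T ys)"
      using qlinear_on_sum_list[OF mcarr_subspace T_lin sub] 1(3) by simp
    moreover have "\<forall>y \<in> set (map T ys). \<exists>\<nu>. \<nu> \<noteq> \<mu> \<and> y \<in> wspace M \<nu>"
      using 1 Cons T_wspace by fastforce
    moreover have "T x \<in> wspace M \<mu>" using T_wspace 1 by blast
    ultimately have "T x = 0" using 1(1) Cons by (metis length_map length_Cons lessI)
    then show ?thesis using Tx c qscale_eq_0 by metis
  qed
qed

lemma f_span_subspace: "qsubspace (f_span M v)"
  using f_span.intros(1,3) f_span.intros(4)[of _ M v] f_span.intros(4)[of v M v 0] unfolding qsubspace_def
  by (auto simp: qscale_simps)

lemma f_span_subset:
  assumes "v \<in> mcarr M" "x \<in> f_span M v"
  shows "x \<in> mcarr M"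
  using assms(2,1) mf_linear mcarr_subspace
  by induction (auto simp: qlinear_on_def qsubspace_def)

text \<open>\<open>q\<^sup>h\<close> commutes with each \<open>f\<^sub>i\<close> up to a scalar, and
  \<open>v\<close> is an eigenvector.\<close>

lemma f_span_mq:
  assumes "v \<in> wspace M \<Lambda>" "x \<in> f_span M v"
  shows "mq M h x \<in> f_span M v"
  using assms(2)
proof induction
  case 1
  have "mq M h v = qscale (qvar powi pairing \<Lambda> h) v" using assms(1) by (simp add: wspace_def)
  then show ?case using f_span.intros(4)[OF f_span.intros(1)] by (simp only:)
next
  case (2 x i)
  have "x \<in> mcarr M" using f_span_subset[of v x] 2 assms wspace_subset by blast
  then show ?case using mq_mf[of x h i] f_span.intros(4)[OF f_span.intros(2)[OF 2(2)]] by (simp only:)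
next
  case (3 x y)
  then have "mq M h (x + y) = mq M h x + mq M h y"
    using f_span_subset[of v] mq_linear[of h] assms wspace_subset unfolding qlinear_on_def by blast
  then show ?case using f_span.intros(3)[OF 3(3,4)] by (simp only:)
next
  case (4 x c)
  then show ?case using f_span_subset[of v] mq_linear[of h] assms wspace_subset f_span.intros(4)
    by (auto simp: qlinear_on_def subset_iff)
qed

text \<open>Moving \<open>e\<^sub>i\<close> past \<open>f\<^sub>j\<close> costs at most a torus
  term, which stays in the span by \<open>f_span_mq\<close>; once it reaches \<open>v\<close> it
  gives \<open>0\<close>.\<close>

lemma f_span_me:
  assumes "highest_weight_vector M \<Lambda> v" "x \<in> f_span M v"
  shows "me M i x \<in> f_span M v"
  using assms(2)
proof induction
  have v: "v \<in> wspace M \<Lambda>" "v \<in> mcarr M"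
    using assms wspace_subset by (auto simp: highest_weight_vector_def)
  {
    case 1
    have "me M i v = 0" using assms(1) by (simp only: highest_weight_vector_def)
    then show ?case using f_span_subspace[of v] by (simp only: qsubspace_def)
  next
    case (2 x j)
    let ?d = "if i = j then qscale (inverse (qi D i - inverse (qi D i))) (mK D M i x - mKinv D M i x)
            else 0"
    have "?d \<in> f_span M v"
    proof (cases "i = j")
      case True
      then show ?thesis
        using f_span.intros(4)[OF qsubspace_diff[OF f_span_subspace f_span_mq[OF v(1) 2(1)] f_span_mq[OF v(1) 2(1)]]]
        by (simp add: mK_def mKinv_def)
    next
      case False
      then show ?thesis using f_span_subspace[of v] by (simp only: qsubspace_def if_False simp_thms)
    qed
    moreover have "me M i (mf M j x) = ?d + mf M j (me M i x)"
      using me_mf[OF f_span_subset[OF v(2) 2(1)], of i j] by (simp only: diff_eq_eq)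
    ultimately show ?case using f_span.intros(3)[OF _ f_span.intros(2)[OF 2(2)]] by (simp only:)
  next
    case (3 x y)
    then have "me M i (x + y) = me M i x + me M i y"
      using f_span_subset[OF v(2)] me_linear[of i] unfolding qlinear_on_def by blast
    then show ?case using f_span.intros(3)[OF 3(3,4)] by (simp only:)
  next
    case (4 x c)
    then show ?case using f_span_subset[OF v(2)] me_linear[of i] f_span.intros(4)
      by (auto simp: qlinear_on_def subset_iff)
  }
qed

text \<open>Each \<open>f\<^sub>i\<close> subtracts a simple root, so a descent from
  \<open>\<Lambda>\<close> never leaves the cone. Lists of summands suit the elimination in
  \<open>weight_vector_sum_zero\<close>.\<close>

lemma f_span_weight_sum:
  assumes "v \<in> wspace M \<Lambda>" "x \<in> f_span M v"
  shows "\<exists>xs. x = sum_list xs \<and> (\<forall>y \<in> set xs. \<exists>\<nu> \<in> root_cone D \<Lambda>. y \<in> wspace M \<nu>)"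
  using assms(2)
proof induction
  case 1
  show ?case using assms root_cone_self by (intro exI[of _ "[v]"]) auto
next
  case (2 x i)
  then obtain xs where xs: "x = sum_list xs" "\<forall>y \<in> set xs. \<exists>\<nu> \<in> root_cone D \<Lambda>. y \<in> wspace M \<nu>"
    by blast
  have "mf M i x = sum_list (map (mf M i) xs)"
    using qlinear_on_sum_list[OF mcarr_subspace mf_linear] xs wspace_subset by blast
  moreover have "\<forall>y \<in> set (map (mf M i) xs). \<exists>\<nu> \<in> root_cone D \<Lambda>. y \<in> wspace M \<nu>"
    using xs(2) mf_wspace root_cone_minus_root by fastforce
  ultimately show ?case by blast
next
  case (3 x y)
  then obtain xs ys where "x = sum_list xs" "\<forall>y \<in> set xs. \<exists>\<nu> \<in> root_cone D \<Lambda>. y \<in> wspace M \<nu>"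
     "y = sum_list ys" "\<forall>y \<in> set ys. \<exists>\<nu> \<in> root_cone D \<Lambda>. y \<in> wspace M \<nu>"
    by blast
  then show ?case by (intro exI[of _ "xs @ ys"]) auto
next
  case (4 x c)
  then obtain xs where xs: "x = sum_list xs" "\<forall>y \<in> set xs. \<exists>\<nu> \<in> root_cone D \<Lambda>. y \<in> wspace M \<nu>"
    by blast
  have "qscale c (sum_list xs) = sum_list (map (qscale c) xs)"
    by (induction xs) (auto simp: qscale_def fun_eq_iff algebra_simps)
  moreover have "\<forall>y \<in> set (map (qscale c) xs). \<exists>\<nu> \<in> root_cone D \<Lambda>. y \<in> wspace M \<nu>"
    using xs(2) wspace_subspace unfolding qsubspace_def by fastforce
  ultimately show ?case using xs(1) by blast
qed

text \<open>Ensures that each class of the crystal basis contains a weight vector, so that the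
  choice of \<open>wt\<close> in \<open>crystal_B\<close> is made from a nonempty set.\<close>

lemma kash_words_weight:
  assumes "v \<in> wspace M \<Lambda>" "x \<in> kash_words D M v"
  shows "\<exists>\<mu>. x \<in> wspace M \<mu>"
  using assms(2)
proof induction
  case base then show ?case using assms by auto
next
  case (step x i y)
  obtain \<mu> N u where d: "string_decomposition D M i \<mu> x N u"
    and y: "y = (\<Sum>k\<le>N. dpow D M i (k + 1) (u k))"
    using step by (auto simp: kash_f_def)
  have pow: "(mf M i ^^ n) z \<in> wspace M (\<kappa> - int n *s root D i)" if "z \<in> wspace M \<kappa>" for n z \<kappa>
  proof (induction n)
    case 0 then show ?case using that by simp
  next
    case (Suc n)
    have "\<kappa> - int n *s root D i - root D i = \<kappa> - int (Suc n) *s root D i"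
      by (simp add: vec_eq_iff algebra_simps)
    then show ?case using mf_wspace[OF Suc, of i] by (metis funpow.simps(2) comp_apply)
  qed
  have "dpow D M i (k + 1) (u k) \<in> wspace M (\<mu> - root D i)" if "k \<le> N" for k
  proof -
    \<comment> \<open>\<open>u k\<close> lies \<open>k\<close> roots above \<open>\<mu>\<close> and
      the divided power descends \<open>k + 1\<close>, so all summands have the same weight.\<close>
    have "\<mu> + int k *s root D i - int (k + 1) *s root D i = \<mu> - root D i"
      by (simp add: vec_eq_iff algebra_simps)
    moreover have "u k \<in> wspace M (\<mu> + int k *s root D i)"
      using d that unfolding string_decomposition_def by blast
    ultimately show ?thesis
      using pow[of "u k" _ "k + 1"] wspace_subspace unfolding dpow_def qsubspace_def by metis
  qed
  then have "y \<in> wspace M (\<mu> - root D i)"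
    unfolding y by (intro qsubspace_sum[OF wspace_subspace]) auto
  then show ?case by blast
qed

end

text \<open>The span of \<open>v\<close> under the \<open>f\<^sub>i\<close> is a submodule
  containing \<open>v\<close>, hence everything. For \<open>\<mu>\<close> outside the cone,
  \<open>x\<close> would be a sum of vectors of other weights, hence \<open>0\<close>.\<close>

lemma highest_weight_module_weight:
  assumes "highest_weight_module D M \<Lambda> v" "x \<in> wspace M \<mu>" "x \<noteq> 0"
  shows "\<mu> \<in> root_cone D \<Lambda>"
proof -
  have M: "uq_module D M" and v: "highest_weight_vector M \<Lambda> v" "v \<in> wspace M \<Lambda>" "v \<in> mcarr M"
    using assms unfolding highest_weight_module_def highest_weight_vector_def wspace_def by auto
  have "uq_submodule M (f_span M v)"
    unfolding uq_submodule_def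
    using f_span_subset[OF M v(3)] f_span_subspace[OF M] f_span_mq[OF M v(2)] f_span_me[OF M v(1)]
    by (auto intro: f_span.intros)
  then have "f_span M v = mcarr M"
    using assms f_span.intros(1) unfolding highest_weight_module_def by blast
  then have "x \<in> f_span M v" using assms by (auto simp: wspace_def)
  then obtain xs where "x = sum_list xs" "\<forall>y \<in> set xs. \<exists>\<nu> \<in> root_cone D \<Lambda>. y \<in> wspace M \<nu>"
    using f_span_weight_sum[OF M v(2)] by blast
  moreover from this have "\<forall>y \<in> set xs. \<exists>\<nu>. \<nu> \<noteq> \<mu> \<and> y \<in> wspace M \<nu>"
    if "\<mu> \<notin> root_cone D \<Lambda>" using that by metis
  ultimately show ?thesis using weight_vector_sum_zero[OF M assms(2)] assms(3) by blast
qed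

section \<open>The crystal lattice and the weights of the crystal\<close>

lemma regular_at_0_closed:
  assumes "r \<in> regular_at_0" "s \<in> regular_at_0"
  shows "r + s \<in> regular_at_0" "- r \<in> regular_at_0"
proof -
  obtain a b c d where *: "r = Fract a b" "poly b 0 \<noteq> 0" "s = Fract c d" "poly d 0 \<noteq> 0"
    using assms by (auto simp: regular_at_0_def)
  then have "b \<noteq> 0" "d \<noteq> 0" by auto
  with * have "r + s = Fract (a * d + c * b) (b * d)" "poly (b * d) 0 \<noteq> 0" by auto
  then show "r + s \<in> regular_at_0" unfolding regular_at_0_def by blast
  show "- r \<in> regular_at_0" using * unfolding regular_at_0_def by (metis (mono_tags, lifting) mem_Collect_eq minus_fract)
qed

lemma zero_regular: "0 \<in> regular_at_0"
proof -
  have "0 = Fract 0 (1 :: rat poly)" "poly (1 :: rat poly) 0 \<noteq> 0" by (simp_all add: Zero_fract_def)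
  then show ?thesis unfolding regular_at_0_def by blast
qed

lemma lattice_zero: "0 \<in> lattice D M v"
  unfolding lattice_def by (auto intro!: exI[of _ "{}"])

lemma lattice_uminus:
  assumes "z \<in> lattice D M v"
  shows "- z \<in> lattice D M v"
proof -
  obtain S c where S: "finite S" "S \<subseteq> kash_words D M v" "c ` S \<subseteq> regular_at_0"
    "z = (\<Sum>x\<in>S. qscale (c x) x)" using assms unfolding lattice_def by blast
  have "- z = (\<Sum>x\<in>S. qscale (- c x) x)"
    unfolding S by (simp add: sum_negf[symmetric] qscale_def fun_eq_iff)
       (simp add: fun_Compl_def sum_negf)
  then show ?thesis using S regular_at_0_closed unfolding lattice_def
    by (auto intro!: exI[of _ S] exI[of _ "\<lambda>x. - c x"])
qed

lemma lattice_add: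
  assumes "z \<in> lattice D M v" "z' \<in> lattice D M v"
  shows "z + z' \<in> lattice D M v"
proof -
  obtain S c where S: "finite S" "S \<subseteq> kash_words D M v" "c ` S \<subseteq> regular_at_0"
    "z = (\<Sum>x\<in>S. qscale (c x) x)" using assms(1) unfolding lattice_def by blast
  obtain S' c' where S': "finite S'" "S' \<subseteq> kash_words D M v" "c' ` S' \<subseteq> regular_at_0"
    "z' = (\<Sum>x\<in>S'. qscale (c' x) x)" using assms(2) unfolding lattice_def by blast
  \<comment> \<open>Coefficients are extended by \<open>0\<close> to the union of the supports, so
    that the sums add termwise.\<close>
  let ?d = "\<lambda>x. if x \<in> S then c x else 0" and ?d' = "\<lambda>x. if x \<in> S' then c' x else 0"
  have "z = (\<Sum>x\<in>S \<union> S'. qscale (?d x) x)"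
    unfolding S by (intro sum.mono_neutral_cong_left) (use S S' in \<open>auto simp: qscale_simps\<close>)
  moreover have "z' = (\<Sum>x\<in>S \<union> S'. qscale (?d' x) x)"
    unfolding S' by (intro sum.mono_neutral_cong_left) (use S S' in \<open>auto simp: qscale_simps\<close>)
  ultimately have "z + z' = (\<Sum>x\<in>S \<union> S'. qscale (?d x + ?d' x) x)"
    by (simp add: qscale_simps sum.distrib)
  moreover have "(\<lambda>x. ?d x + ?d' x) ` (S \<union> S') \<subseteq> regular_at_0"
    using S S' zero_regular regular_at_0_closed by (auto simp: image_subset_iff)
  ultimately show ?thesis using S S' unfolding lattice_def mem_Collect_eq
    by (intro exI[of _ "S \<union> S'"] exI[of _ "\<lambda>x. ?d x + ?d' x"] conjI) simp_all
qed

text \<open>A class that contains \<open>0\<close> is the class of \<open>0\<close>, which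
  \<open>crystal_basis\<close> removes.\<close>

lemma zero_notin_crystal_basis:
  assumes "b \<in> crystal_basis D M v"
  shows "0 \<notin> b"
proof
  assume "0 \<in> b"
  obtain x where x: "b = residue_class D M v x" using assms by (auto simp: crystal_basis_def)
  then obtain z where z: "z \<in> lattice D M v" "0 = x + qscale qvar z"
    using \<open>0 \<in> b\<close> by (auto simp: residue_class_def)
  then have "x = - qscale qvar z" by (metis add_eq_0_iff2)
  \<comment> \<open>Since \<open>x\<close> is \<open>q\<close> times a lattice vector, shifting by
    \<open>z\<close> carries each of the two classes into the other.\<close>
  then have "x + qscale qvar z' = 0 + qscale qvar (z' + - z)"
      "0 + qscale qvar z' = x + qscale qvar (z' + z)" for z'
    by (simp_all add: qscale_simps algebra_simps)
  then have "residue_class D M v x = residue_class D M v 0"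
    using lattice_add lattice_uminus z(1) unfolding residue_class_def
    by (intro subset_antisym subsetI) (blast+)
  then show False using assms x by (auto simp: crystal_basis_def)
qed

text \<open>Works for whichever weight \<open>SOME\<close> picks: a vector of that weight lies in
  \<open>b\<close>, and it is nonzero because \<open>b\<close> avoids \<open>0\<close>.\<close>

lemma crystal_B_weight:
  assumes "highest_weight_module D M \<Lambda> v" "b \<in> carr (crystal_B D M v)"
  shows "wt (crystal_B D M v) b \<in> root_cone D \<Lambda>"
proof -
  have b: "b \<in> crystal_basis D M v" using assms by (auto simp: crystal_B_def Let_def)
  then obtain x where x: "x \<in> kash_words D M v" "b = residue_class D M v x"
    by (auto simp: crystal_basis_def)
  have "x \<in> b"
    unfolding x residue_class_def using lattice_zero by (auto intro!: exI[of _ 0] simp: qscale_simps)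
  moreover have "uq_module D M" "v \<in> wspace M \<Lambda>"
    using assms(1) unfolding highest_weight_module_def highest_weight_vector_def by simp_all
  then have "\<exists>\<mu>. x \<in> wspace M \<mu>" using kash_words_weight x(1) by metis
  ultimately have "\<exists>\<mu>. b \<inter> wspace M \<mu> \<noteq> {}" by blast
  then have "b \<inter> wspace M (SOME \<mu>. b \<inter> wspace M \<mu> \<noteq> {}) \<noteq> {}"
    by (rule someI_ex)
  then obtain y where y: "y \<in> b" "y \<in> wspace M (wt (crystal_B D M v) b)"
    by (auto simp: crystal_B_def Let_def)
  then have "y \<noteq> 0" using zero_notin_crystal_basis[OF b] by auto
  then show ?thesis using highest_weight_module_weight assms(1) y(2) by blast
qed

section \<open>Termination of the raising operators\<close>

lemma crystal_component_weights:
  assumes "is_crystal D \<Gamma>" "x \<in> carr \<Gamma>"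
  shows "\<exists>\<Lambda>. \<forall>y \<in> carr (component \<Gamma> x). wt \<Gamma> y \<in> root_cone D \<Lambda>"
proof -
  obtain \<Lambda> M v \<psi> where hw: "highest_weight_module D M \<Lambda> v"
    and \<psi>: "crystal_morphism (component \<Gamma> x) (crystal_B D M v) \<psi>"
    using assms unfolding is_crystal_def crystal_iso_def by blast
  have "wt \<Gamma> y \<in> root_cone D \<Lambda>" if "y \<in> carr (component \<Gamma> x)" for y
  proof -
    have "\<psi> y \<in> carr (crystal_B D M v)" "wt (crystal_B D M v) (\<psi> y) = wt (component \<Gamma> x) y"
      using \<psi> that by (simp_all add: crystal_morphism_def)
    moreover have "wt (component \<Gamma> x) y = wt \<Gamma> y" by (simp add: component_def)
    ultimately show ?thesis using crystal_B_weight[OF hw] by metis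
  qed
  then show ?thesis by blast
qed

text \<open>The raised element comes first, so that well-foundedness excludes infinite chains of
  raising operators.\<close>

definition e_edges :: "('x, 'i, 'r::finite) crystal \<Rightarrow> ('x \<times> 'x) set" where
  "e_edges \<Gamma> = {(y, x). x \<in> carr \<Gamma> \<and> (\<exists>i. ce \<Gamma> i x = Some y)}"

text \<open>By independence of the simple roots, \<open>e\<^sub>j\<close> lowers the
  \<open>j\<close>-th coefficient below \<open>\<Lambda>\<close> by one and fixes the others. Along
  an infinite chain the sum of these natural coefficients would decrease forever.\<close>

lemma wf_e_edges:
  fixes D :: "('i::finite, 'r::finite) datum"
  assumes D: "kac_moody_datum D" and \<Gamma>: "is_crystal D \<Gamma>"
  shows "wf (e_edges \<Gamma>)"
  unfolding wf_iff_no_infinite_down_chain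
proof
  assume "\<exists>x. \<forall>n. (x (Suc n), x n) \<in> e_edges \<Gamma>"
  then obtain x where x: "\<And>n. (x (Suc n), x n) \<in> e_edges \<Gamma>" by blast
  \<comment> \<open>The chain stays in the component of its start, so a single
    \<open>\<Lambda>\<close> serves for all its weights.\<close>
  have "x n \<in> carr (component \<Gamma> (x 0))" for n
  proof (induction n)
    case 0 show ?case by (simp add: component_def)
  next
    case (Suc n)
    have "(x n, x (Suc n)) \<in> kashiwara_edges \<Gamma> \<union> (kashiwara_edges \<Gamma>)\<inverse>"
      using x[of n] by (auto simp: e_edges_def kashiwara_edges_def)
    with Suc show ?case by (auto simp: component_def intro: rtrancl_into_rtrancl)
  qed
  moreover have "x 0 \<in> carr \<Gamma>" using x[of 0] by (simp add: e_edges_def)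
  ultimately obtain \<Lambda> where "\<And>n. wt \<Gamma> (x n) \<in> root_cone D \<Lambda>"
    using crystal_component_weights[OF \<Gamma>] by blast
  then have "\<forall>n. \<exists>c :: 'i \<Rightarrow> nat. wt \<Gamma> (x n) = \<Lambda> - (\<Sum>i\<in>UNIV. int (c i) *s root D i)"
    by (auto simp: root_cone_def)
  then obtain c :: "nat \<Rightarrow> 'i \<Rightarrow> nat"
    where c: "\<And>n. wt \<Gamma> (x n) = \<Lambda> - (\<Sum>i\<in>UNIV. int (c n i) *s root D i)" by metis
  have "(\<Sum>i\<in>UNIV. c (Suc n) i) < (\<Sum>i\<in>UNIV. c n i)" for n
  proof -
    obtain j where j: "ce \<Gamma> j (x n) = Some (x (Suc n))" "x n \<in> carr \<Gamma>"
      using x[of n] by (auto simp: e_edges_def)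
    then have w: "wt \<Gamma> (x (Suc n)) = wt \<Gamma> (x n) + root D j"
      using \<Gamma> unfolding is_crystal_def normal_crystal_def by metis
    \<comment> \<open>Both expressions for the weight of \<open>x (Suc n)\<close> are gathered into
      one vanishing combination of simple roots; the \<open>1\<close> at \<open>j\<close> is the
      root gained by \<open>e\<^sub>j\<close>.\<close>
    have "(\<Sum>i\<in>UNIV. (int (c (Suc n) i) - int (c n i) + (if i = j then 1 else 0)) *s root D i)
      = (\<Sum>i\<in>UNIV. int (c (Suc n) i) *s root D i - int (c n i) *s root D i + (if i = j then root D i else 0))"
      by (intro sum.cong) (auto simp: vec_eq_iff algebra_simps)
    also have "\<dots> = (\<Sum>i\<in>UNIV. int (c (Suc n) i) *s root D i) - (\<Sum>i\<in>UNIV. int (c n i) *s root D i) + root D j"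
      by (simp add: sum.distrib sum_subtractf)
    also have "\<dots> = 0" using w unfolding c by (simp add: algebra_simps)
    finally have z: "(\<Sum>i\<in>UNIV. (int (c (Suc n) i) - int (c n i) + (if i = j then 1 else 0)) *s root D i) = 0" .
    have "Z_independent (root D)" using D by (simp only: kac_moody_datum_def)
    then have "int (c (Suc n) i) - int (c n i) + (if i = j then 1 else 0) = 0" for i
      using z unfolding Z_independent_def
      by (elim allE[of _ "\<lambda>i. int (c (Suc n) i) - int (c n i) + (if i = j then 1 else 0)"] impE)
        (assumption, erule spec)
    then have le: "int (c (Suc n) i) = int (c n i) - (if i = j then 1 else 0)" for i
      by (simp add: algebra_simps)
    show ?thesis
    proof (rule sum_strict_mono_ex1)
      show "\<forall>i\<in>UNIV. c (Suc n) i \<le> c n i"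
      proof
        fix i show "c (Suc n) i \<le> c n i" using le[of i] by (cases "i = j") auto
      qed
      show "\<exists>i\<in>UNIV. c (Suc n) i < c n i"
        using le[of j] by (intro bexI[of _ j]) auto
    qed simp
  qed
  then have "\<forall>n. ((\<lambda>n. \<Sum>i\<in>UNIV. c n i) (Suc n), (\<lambda>n. \<Sum>i\<in>UNIV. c n i) n) \<in> less_than" by simp
  then have "\<exists>f. \<forall>n. (f (Suc n), f n) \<in> less_than"
    by (rule exI[of _ "\<lambda>n. \<Sum>i\<in>UNIV. c n i"])
  then show False using wf_less_than unfolding wf_iff_no_infinite_down_chain by (rule notE[rotated])
qed

section \<open>Words\<close>

lemma is_max_iter_unique: "is_max_iter k x m \<Longrightarrow> is_max_iter k x m' \<Longrightarrow> m = m'"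
  unfolding is_max_iter_def by (metis order_antisym)

lemma iter_Suc: "k x = Some y \<Longrightarrow> iter k (Suc n) x = iter k n y"
  unfolding iter_def by (simp add: funpow_Suc_right del: funpow.simps)

text \<open>One application uses up one unit of the string. This serves \<open>ce\<close> with
  \<open>eps\<close> and \<open>cf\<close> with \<open>phi\<close> alike.\<close>

lemma is_max_iter_Some:
  assumes "k x = Some y" "is_max_iter k x m"
  shows "is_max_iter k y (m - 1)"
proof -
  obtain n where n: "m = int n" "iter k n x \<noteq> None" "\<And>n'. iter k n' x \<noteq> None \<Longrightarrow> n' \<le> n"
    using assms(2) unfolding is_max_iter_def by blast
  have "iter k (Suc 0) x \<noteq> None" using assms by (simp add: iter_def)
  then obtain n' where n': "n = Suc n'" using n(3) by (metis Suc_le_D)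
  show ?thesis unfolding is_max_iter_def
  proof (intro exI[of _ n'] conjI allI impI)
    show "m - 1 = int n'" using n n' by simp
    show "iter k n' y \<noteq> None" using n(2) n' iter_Suc[of k x y, OF assms(1)] by metis
    fix l assume "iter k l y \<noteq> None"
    then have "Suc l \<le> n" using n(3) iter_Suc[of k x y, OF assms(1)] by metis
    then show "l \<le> n'" using n' by simp
  qed
qed

section \<open>The tensor product rule on words\<close>

locale normal_crystal_loc =
  fixes D :: "('i, 'r::finite) datum" and \<Gamma> :: "('x, 'i, 'r) crystal"
  assumes normal: "normal_crystal D \<Gamma>"
begin

lemma eps_max: "x \<in> carr \<Gamma> \<Longrightarrow> is_max_iter (ce \<Gamma> i) x (eps \<Gamma> i x)"
  and phi_max: "x \<in> carr \<Gamma> \<Longrightarrow> is_max_iter (cf \<Gamma> i) x (phi \<Gamma> i x)"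
  and ce_carr: "x \<in> carr \<Gamma> \<Longrightarrow> ce \<Gamma> i x = Some y \<Longrightarrow> y \<in> carr \<Gamma>"
  and cf_carr: "x \<in> carr \<Gamma> \<Longrightarrow> cf \<Gamma> i x = Some y \<Longrightarrow> y \<in> carr \<Gamma>"
  and ce_iff_cf: "x \<in> carr \<Gamma> \<Longrightarrow> y \<in> carr \<Gamma> \<Longrightarrow> ce \<Gamma> i x = Some y \<longleftrightarrow> cf \<Gamma> i y = Some x"
  using normal unfolding normal_crystal_def by blast+

lemma eps_nonneg: "x \<in> carr \<Gamma> \<Longrightarrow> eps \<Gamma> i x \<ge> 0"
  using eps_max[of x i] unfolding is_max_iter_def by auto

lemma ce_Some:
  assumes "x \<in> carr \<Gamma>" "ce \<Gamma> i x = Some y"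
  shows "cf \<Gamma> i y = Some x" "eps \<Gamma> i y = eps \<Gamma> i x - 1" "phi \<Gamma> i y = phi \<Gamma> i x + 1"
proof -
  have y: "y \<in> carr \<Gamma>" using ce_carr assms by blast
  show f: "cf \<Gamma> i y = Some x" using ce_iff_cf y assms by blast
  show "eps \<Gamma> i y = eps \<Gamma> i x - 1"
    by (rule is_max_iter_unique[OF eps_max[OF y] is_max_iter_Some[OF assms(2) eps_max[OF assms(1)]]])
  \<comment> \<open>Here the string is read from \<open>y\<close>, since \<open>cf\<close> leads
    from \<open>y\<close> back to \<open>x\<close>.\<close>
  have "phi \<Gamma> i x = phi \<Gamma> i y - 1"
    by (rule is_max_iter_unique[OF phi_max[OF assms(1)] is_max_iter_Some[OF f phi_max[OF y]]])
  then show "phi \<Gamma> i y = phi \<Gamma> i x + 1" by simp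
qed

abbreviation W where "W \<equiv> lists (carr \<Gamma>)"

lemma word_eps_nonneg: "w \<in> W \<Longrightarrow> word_eps \<Gamma> i w \<ge> 0"
  by (induction w) (use eps_nonneg in \<open>force+\<close>)

lemma word_e_carr: "w \<in> W \<Longrightarrow> word_e \<Gamma> i w = Some w' \<Longrightarrow> w' \<in> W"
proof (induction w arbitrary: w')
  case (Cons x w)
  then have x: "x \<in> carr \<Gamma>" "w \<in> W" by auto
  show ?case
  proof (cases "phi \<Gamma> i x \<ge> word_eps \<Gamma> i w")
    case True
    with Cons.prems(2) obtain y where "ce \<Gamma> i x = Some y" "w' = y # w" by auto
    then show ?thesis using ce_carr[OF x(1)] x(2) by simp
  next
    case False
    with Cons.prems(2) obtain u where "word_e \<Gamma> i w = Some u" "w' = x # u" by auto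
    then show ?thesis using Cons.IH[OF x(2)] x(1) by simp
  qed
qed simp

lemma word_f_carr: "w \<in> W \<Longrightarrow> word_f \<Gamma> i w = Some w' \<Longrightarrow> w' \<in> W"
proof (induction w arbitrary: w')
  case (Cons x w)
  then have x: "x \<in> carr \<Gamma>" "w \<in> W" by auto
  show ?case
  proof (cases "phi \<Gamma> i x > word_eps \<Gamma> i w")
    case True
    with Cons.prems(2) obtain y where "cf \<Gamma> i x = Some y" "w' = y # w" by auto
    then show ?thesis using cf_carr[OF x(1)] x(2) by simp
  next
    case False
    with Cons.prems(2) obtain u where "word_f \<Gamma> i w = Some u" "w' = x # u" by auto
    then show ?thesis using Cons.IH[OF x(2)] x(1) by simp
  qed
qed simp

lemma word_e_length: "word_e \<Gamma> i w = Some w' \<Longrightarrow> length w' = length w"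
  by (induction w arbitrary: w') (auto split: if_splits)

text \<open>The two inequalities of the tensor rule match: raising a letter under
  \<open>\<ge>\<close> increases its \<open>phi\<close> by one, so \<open>>\<close> holds
  afterwards; raising the rest lowers its \<open>word_eps\<close> by one, and \<open>>\<close> still
  fails. Hence \<open>f\<^sub>i\<close> returns to the same letter.\<close>

lemma word_e_Some:
  assumes "w \<in> W" "word_e \<Gamma> i w = Some w'"
  shows "word_f \<Gamma> i w' = Some w \<and> word_eps \<Gamma> i w' = word_eps \<Gamma> i w - 1
     \<and> word_phi \<Gamma> i w' = word_phi \<Gamma> i w + 1"
  using assms
proof (induction w arbitrary: w')
  case (Cons x w)
  then have x: "x \<in> carr \<Gamma>" "w \<in> W" by auto
  show ?case
  proof (cases "phi \<Gamma> i x \<ge> word_eps \<Gamma> i w")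
    case True
    with Cons obtain y where y: "ce \<Gamma> i x = Some y" "w' = y # w" by auto
    then show ?thesis using ce_Some[OF x(1) y(1)] True by auto
  next
    case False
    with Cons obtain u where u: "word_e \<Gamma> i w = Some u" "w' = x # u" by auto
    then show ?thesis using Cons.IH[OF u(1)] False by auto
  qed
qed simp

text \<open>\<open>e\<^sub>i\<close> would lower \<open>word_eps\<close> by one, below
  \<open>0\<close>.\<close>

lemma word_eps_0: "w \<in> W \<Longrightarrow> word_eps \<Gamma> i w \<le> 0 \<Longrightarrow> word_e \<Gamma> i w = None"
proof (rule ccontr)
  assume w: "w \<in> W" "word_eps \<Gamma> i w \<le> 0" "word_e \<Gamma> i w \<noteq> None"
  then obtain w' where "word_e \<Gamma> i w = Some w'" by auto
  then have "w' \<in> W" "word_eps \<Gamma> i w' = word_eps \<Gamma> i w - 1"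
    using word_e_carr word_e_Some w(1) by blast+
  then show False using word_eps_nonneg[of w' i] w(2) by linarith
qed

text \<open>Associativity of the tensor rule: a word may be cut anywhere, not only after its first
  letter.\<close>

lemma word_eps_append:
  "u \<in> W \<Longrightarrow> v \<in> W \<Longrightarrow>
    word_eps \<Gamma> i (u @ v) = word_eps \<Gamma> i u + max 0 (word_eps \<Gamma> i v - word_phi \<Gamma> i u)"
proof (induction u)
  case Nil
  then show ?case using word_eps_nonneg[of v i] by auto
next
  case (Cons x u)
  then show ?case by (auto simp: max_def)
qed

lemma word_e_append:
  "u \<in> W \<Longrightarrow> v \<in> W \<Longrightarrow> word_e \<Gamma> i (u @ v) =
     (if word_phi \<Gamma> i u \<ge> word_eps \<Gamma> i v then map_option (\<lambda>u'. u' @ v) (word_e \<Gamma> i u)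
      else map_option (\<lambda>v'. u @ v') (word_e \<Gamma> i v))"
proof (induction u)
  case Nil
  \<comment> \<open>If \<open>word_eps\<close> of \<open>v\<close> is \<open>0\<close>, the rule
    selects the empty word and gives \<open>None\<close>; \<open>v\<close> is then annihilated as
    well.\<close>
  then show ?case using word_eps_0[of v i] by (cases "word_e \<Gamma> i v") auto
next
  case (Cons x u)
  then have "x \<in> carr \<Gamma>" "u \<in> W" by auto
  with Cons show ?case
    by (auto simp: word_eps_append max_def option.map_comp comp_def intro!: option.map_cong0)
qed

lemma word_f_append:
  "u \<in> W \<Longrightarrow> v \<in> W \<Longrightarrow> word_f \<Gamma> i (u @ v) =
     (if word_phi \<Gamma> i u > word_eps \<Gamma> i v then map_option (\<lambda>u'. u' @ v) (word_f \<Gamma> i u)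
      else map_option (\<lambda>v'. u @ v') (word_f \<Gamma> i v))"
proof (induction u)
  case Nil
  then show ?case using word_eps_nonneg[of v i] by (cases "word_f \<Gamma> i v") auto
next
  case (Cons x u)
  then have "x \<in> carr \<Gamma>" "u \<in> W" by auto
  with Cons show ?case
    by (auto simp: word_eps_append max_def option.map_comp comp_def intro!: option.map_cong0)
qed

text \<open>\<open>e\<^sub>i\<close> changes one letter, along \<open>e_edges\<close>;
  well-foundedness thus passes from letters to words through \<open>listrel1\<close>.\<close>

lemma word_e_listrel1:
  "w \<in> W \<Longrightarrow> word_e \<Gamma> i w = Some w' \<Longrightarrow> (w', w) \<in> listrel1 (e_edges \<Gamma>)"
  by (induction w arbitrary: w') (auto split: if_splits simp: e_edges_def)

end

lemma wf_word_e:
  assumes "kac_moody_datum (D :: ('i::finite, 'r::finite) datum)" "is_crystal D \<Gamma>"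
  shows "wf {(w', w). w \<in> lists (carr \<Gamma>) \<and> (\<exists>i. word_e \<Gamma> i w = Some w')}"
proof -
  interpret normal_crystal_loc D \<Gamma>
    using assms(2) by unfold_locales (simp add: is_crystal_def)
  have "{(w', w). w \<in> lists (carr \<Gamma>) \<and> (\<exists>i. word_e \<Gamma> i w = Some w')} \<subseteq> listrel1 (e_edges \<Gamma>)"
    using word_e_listrel1 by auto
  then show ?thesis using wf_e_edges[OF assms] by (meson wf_listrel1_iff wf_subset)
qed

context normal_crystal_loc
begin

text \<open>The tests that select the active factor see \<open>s\<close> only through
  \<open>word_eps\<close> and \<open>word_phi\<close>, so they agree for any two middle words with
  the same values.\<close>

lemma word_e_append3:
  assumes "u \<in> W" "s \<in> W" "v \<in> W"
  shows "word_e \<Gamma> i (u @ s @ v) =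
     (if word_phi \<Gamma> i u \<ge> word_eps \<Gamma> i s + max 0 (word_eps \<Gamma> i v - word_phi \<Gamma> i s)
      then map_option (\<lambda>u'. u' @ s @ v) (word_e \<Gamma> i u)
      else if word_phi \<Gamma> i s \<ge> word_eps \<Gamma> i v then map_option (\<lambda>s'. u @ s' @ v) (word_e \<Gamma> i s)
      else map_option (\<lambda>v'. u @ s @ v') (word_e \<Gamma> i v))"
  using assms by (simp add: word_e_append word_eps_append option.map_comp comp_def)

lemma word_f_append3:
  assumes "u \<in> W" "s \<in> W" "v \<in> W"
  shows "word_f \<Gamma> i (u @ s @ v) =
     (if word_phi \<Gamma> i u > word_eps \<Gamma> i s + max 0 (word_eps \<Gamma> i v - word_phi \<Gamma> i s)
      then map_option (\<lambda>u'. u' @ s @ v) (word_f \<Gamma> i u)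
      else if word_phi \<Gamma> i s > word_eps \<Gamma> i v then map_option (\<lambda>s'. u @ s' @ v) (word_f \<Gamma> i s)
      else map_option (\<lambda>v'. u @ s @ v') (word_f \<Gamma> i v))"
  using assms by (simp add: word_f_append word_eps_append option.map_comp comp_def)

end

section \<open>Rewriting in crystal polygraphs\<close>

text \<open>A peak is closed in three stages: local confluence at \<open>x\<close>, the induction
  hypothesis at \<open>y1\<close>, then the one at \<open>z1\<close>.\<close>

lemma newman:
  assumes wf: "wf (r\<inverse>)"
    and local: "\<And>x y z. (x, y) \<in> r \<Longrightarrow> (x, z) \<in> r \<Longrightarrow> \<exists>w. (y, w) \<in> r\<^sup>* \<and> (z, w) \<in> r\<^sup>*"
  shows "(x, y) \<in> r\<^sup>* \<Longrightarrow> (x, z) \<in> r\<^sup>* \<Longrightarrow> \<exists>w. (y, w) \<in> r\<^sup>* \<and> (z, w) \<in> r\<^sup>*"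
proof (induction x arbitrary: y z rule: wf_induct_rule[OF wf])
  case (1 x)
  show ?case
  proof (cases "x = y \<or> x = z")
    case True then show ?thesis using 1 by blast
  next
    case False
    then obtain y1 z1 where y1: "(x, y1) \<in> r" "(y1, y) \<in> r\<^sup>*" and z1: "(x, z1) \<in> r" "(z1, z) \<in> r\<^sup>*"
      using 1 by (meson converse_rtranclE)
    obtain u where u: "(y1, u) \<in> r\<^sup>*" "(z1, u) \<in> r\<^sup>*" using local y1 z1 by blast
    obtain s where s: "(y, s) \<in> r\<^sup>*" "(u, s) \<in> r\<^sup>*" using 1(1)[of y1] y1 u by blast
    obtain t where "(s, t) \<in> r\<^sup>*" "(z, t) \<in> r\<^sup>*"
      using 1(1)[of z1 s z] z1 u s by (meson converse_iff rtrancl_trans)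
    then show ?thesis using s by (meson rtrancl_trans)
  qed
qed

section \<open>Transport of single steps by the Kashiwara operators\<close>

locale crystal_polygraph =
  fixes D :: "('i::finite, 'r::finite) datum" and X :: "('a, 'b, 'i, 'r) polygraph"
  assumes datum: "kac_moody_datum D" and polygraph: "crystal_2polygraph D X"
begin

sublocale A: normal_crystal_loc D "gen1 X"
  using polygraph by unfold_locales (simp add: crystal_2polygraph_def is_crystal_def)

sublocale B: normal_crystal_loc D "gen2 X"
  using polygraph by unfold_locales (simp add: crystal_2polygraph_def is_crystal_def)

abbreviation "E \<equiv> word_e (gen1 X)"
abbreviation "F \<equiv> word_f (gen1 X)"
abbreviation "steps \<equiv> carr (step_crystal X)"

lemma words_eq: "words X = lists (carr (gen1 X))"
  by (simp add: words_def free_monoid_def)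

lemma words_append: "u @ v \<in> words X \<longleftrightarrow> u \<in> words X \<and> v \<in> words X"
  by (auto simp: words_eq)

lemma steps_iff: "(t, \<alpha>, v) \<in> steps \<longleftrightarrow> t \<in> words X \<and> \<alpha> \<in> carr (gen2 X) \<and> v \<in> words X"
  by (simp add: step_crystal_def Let_def)

lemma morphism_word:
  assumes "crystal_morphism (gen2 X) (free_monoid (gen1 X)) \<psi>" "\<alpha> \<in> carr (gen2 X)"
  shows "\<psi> \<alpha> \<in> words X" "word_eps (gen1 X) i (\<psi> \<alpha>) = eps (gen2 X) i \<alpha>"
    "word_phi (gen1 X) i (\<psi> \<alpha>) = phi (gen2 X) i \<alpha>"
    "E i (\<psi> \<alpha>) = map_option \<psi> (ce (gen2 X) i \<alpha>)" "F i (\<psi> \<alpha>) = map_option \<psi> (cf (gen2 X) i \<alpha>)"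
  using assms by (simp_all add: crystal_morphism_def words_def) (simp_all add: free_monoid_def)

lemma src_morphism: "crystal_morphism (gen2 X) (free_monoid (gen1 X)) (src X)"
  and tgt_morphism: "crystal_morphism (gen2 X) (free_monoid (gen1 X)) (tgt X)"
  using polygraph by (simp_all add: crystal_2polygraph_def)

lemmas src_word = morphism_word[OF src_morphism]
lemmas tgt_word = morphism_word[OF tgt_morphism]

lemma step_src_words: "\<gamma> \<in> steps \<Longrightarrow> step_src X \<gamma> \<in> words X"
  and step_tgt_words: "\<gamma> \<in> steps \<Longrightarrow> step_tgt X \<gamma> \<in> words X"
  by (cases \<gamma>; simp add: steps_iff words_append src_word tgt_word)+

text \<open>As \<open>\<psi>\<close> preserves \<open>eps\<close> and \<open>phi\<close>, the tests
  mention \<open>\<alpha>\<close> but not \<open>\<psi>\<close>. So the same one of the three parts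
  is active in the source and in the target of a step.\<close>

lemma E_morphism:
  assumes "crystal_morphism (gen2 X) (free_monoid (gen1 X)) \<psi>" "(t, \<alpha>, v) \<in> steps"
  shows "E i (t @ \<psi> \<alpha> @ v) =
     (if word_phi (gen1 X) i t \<ge> eps (gen2 X) i \<alpha> + max 0 (word_eps (gen1 X) i v - phi (gen2 X) i \<alpha>)
      then map_option (\<lambda>t'. t' @ \<psi> \<alpha> @ v) (E i t)
      else if phi (gen2 X) i \<alpha> \<ge> word_eps (gen1 X) i v
      then map_option (\<lambda>\<alpha>'. t @ \<psi> \<alpha>' @ v) (ce (gen2 X) i \<alpha>)
      else map_option (\<lambda>v'. t @ \<psi> \<alpha> @ v') (E i v))"
  using assms(2) A.word_e_append3[of t "\<psi> \<alpha>" v i] morphism_word[OF assms(1)]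
  by (simp add: steps_iff words_eq option.map_comp comp_def)

lemma F_morphism:
  assumes "crystal_morphism (gen2 X) (free_monoid (gen1 X)) \<psi>" "(t, \<alpha>, v) \<in> steps"
  shows "F i (t @ \<psi> \<alpha> @ v) =
     (if word_phi (gen1 X) i t > eps (gen2 X) i \<alpha> + max 0 (word_eps (gen1 X) i v - phi (gen2 X) i \<alpha>)
      then map_option (\<lambda>t'. t' @ \<psi> \<alpha> @ v) (F i t)
      else if phi (gen2 X) i \<alpha> > word_eps (gen1 X) i v
      then map_option (\<lambda>\<alpha>'. t @ \<psi> \<alpha>' @ v) (cf (gen2 X) i \<alpha>)
      else map_option (\<lambda>v'. t @ \<psi> \<alpha> @ v') (F i v))"
  using assms(2) A.word_f_append3[of t "\<psi> \<alpha>" v i] morphism_word[OF assms(1)]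
  by (simp add: steps_iff words_eq option.map_comp comp_def)

text \<open>These lengths locate the rewritten factor; for distinct steps with a common source they
  decide whether the branching is critical.\<close>

fun same_shape :: "('a, 'b) rstep \<Rightarrow> ('a, 'b) rstep \<Rightarrow> bool" where
  "same_shape (t, \<alpha>, v) (t', \<alpha>', v') \<longleftrightarrow>
     length t = length t' \<and> length (src X \<alpha>) = length (src X \<alpha>') \<and> length v = length v'"

text \<open>What is needed of the raised step, in place of the case distinction in
  \<open>step_op\<close>. The clause on 2-generators is there to recover \<open>\<gamma>\<close>
  from \<open>\<gamma>'\<close> in \<open>e_lift_inj\<close>.\<close>

definition e_lift :: "'i \<Rightarrow> ('a, 'b) rstep \<Rightarrow> ('a, 'b) rstep \<Rightarrow> bool" where
  "e_lift i \<gamma> \<gamma>' \<longleftrightarrow> \<gamma>' \<in> steps \<and>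
     E i (step_src X \<gamma>) = Some (step_src X \<gamma>') \<and> E i (step_tgt X \<gamma>) = Some (step_tgt X \<gamma>') \<and>
     same_shape \<gamma> \<gamma>' \<and>
     (fst (snd \<gamma>) = fst (snd \<gamma>') \<or> ce (gen2 X) i (fst (snd \<gamma>)) = Some (fst (snd \<gamma>')))"

lemma e_lift_exists:
  assumes "\<gamma> \<in> steps" "E i (step_src X \<gamma>) \<noteq> None"
  shows "\<exists>\<gamma>'. e_lift i \<gamma> \<gamma>'"
proof -
  obtain t \<alpha> v where \<gamma>: "\<gamma> = (t, \<alpha>, v)" by (cases \<gamma>)
  have s: "t \<in> words X" "\<alpha> \<in> carr (gen2 X)" "v \<in> words X" using assms by (simp_all add: \<gamma> steps_iff)
  note e = E_morphism[OF src_morphism, of t \<alpha> v i] E_morphism[OF tgt_morphism, of t \<alpha> v i]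
  let ?c1 = "word_phi (gen1 X) i t \<ge> eps (gen2 X) i \<alpha> + max 0 (word_eps (gen1 X) i v - phi (gen2 X) i \<alpha>)"
  let ?c2 = "phi (gen2 X) i \<alpha> \<ge> word_eps (gen1 X) i v"
  consider (left) "?c1" | (mid) "\<not> ?c1" "?c2" | (right) "\<not> ?c1" "\<not> ?c2" by blast
  then show ?thesis
  proof cases
    case left
    then obtain t' where t': "E i t = Some t'" using assms e \<gamma> by auto
    then have "e_lift i \<gamma> (t', \<alpha>, v)"
      using left assms e s A.word_e_carr[of t i t'] A.word_e_length[of i t t']
      by (simp add: \<gamma> e_lift_def steps_iff words_eq)
    then show ?thesis by blast
  next
    case mid
    then obtain \<alpha>' where \<alpha>': "ce (gen2 X) i \<alpha> = Some \<alpha>'" using assms e \<gamma> by auto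
    have "length (src X \<alpha>') = length (src X \<alpha>)"
      using A.word_e_length[of i "src X \<alpha>" "src X \<alpha>'"] src_word(4)[OF s(2)] \<alpha>' by simp
    then have "e_lift i \<gamma> (t, \<alpha>', v)"
      using mid assms e s B.ce_carr[OF s(2) \<alpha>'] \<alpha>'
      by (simp add: \<gamma> e_lift_def steps_iff words_eq)
    then show ?thesis by blast
  next
    case right
    then obtain v' where v': "E i v = Some v'" using assms e \<gamma> by auto
    then have "e_lift i \<gamma> (t, \<alpha>, v')"
      using right assms e s A.word_e_carr[of v i v'] A.word_e_length[of i v v']
      by (simp add: \<gamma> e_lift_def steps_iff words_eq)
    then show ?thesis by blast
  qed
qed

lemma F_step:
  assumes "\<gamma> \<in> steps" "F i (step_src X \<gamma>) = Some w"
  shows "\<exists>\<gamma>' \<in> steps. step_src X \<gamma>' = w \<and> F i (step_tgt X \<gamma>) = Some (step_tgt X \<gamma>')"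
proof -
  obtain t \<alpha> v where \<gamma>: "\<gamma> = (t, \<alpha>, v)" by (cases \<gamma>)
  have s: "t \<in> words X" "\<alpha> \<in> carr (gen2 X)" "v \<in> words X" using assms by (simp_all add: \<gamma> steps_iff)
  note f = F_morphism[OF src_morphism, of t \<alpha> v i] F_morphism[OF tgt_morphism, of t \<alpha> v i]
  let ?c1 = "word_phi (gen1 X) i t > eps (gen2 X) i \<alpha> + max 0 (word_eps (gen1 X) i v - phi (gen2 X) i \<alpha>)"
  let ?c2 = "phi (gen2 X) i \<alpha> > word_eps (gen1 X) i v"
  consider (left) "?c1" | (mid) "\<not> ?c1" "?c2" | (right) "\<not> ?c1" "\<not> ?c2" by blast
  then show ?thesis
  proof cases
    case left
    then obtain t' where t': "F i t = Some t'" using assms f \<gamma> by auto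
    then show ?thesis
      using left assms f s A.word_f_carr[of t i t']
      by (intro bexI[of _ "(t', \<alpha>, v)"]) (simp_all add: \<gamma> steps_iff words_eq)
  next
    case mid
    then obtain \<alpha>' where \<alpha>': "cf (gen2 X) i \<alpha> = Some \<alpha>'" using assms f \<gamma> by auto
    then show ?thesis
      using mid assms f s B.cf_carr[OF s(2) \<alpha>']
      by (intro bexI[of _ "(t, \<alpha>', v)"]) (simp_all add: \<gamma> steps_iff words_eq)
  next
    case right
    then obtain v' where v': "F i v = Some v'" using assms f \<gamma> by auto
    then show ?thesis
      using right assms f s A.word_f_carr[of v i v']
      by (intro bexI[of _ "(t, \<alpha>, v')"]) (simp_all add: \<gamma> steps_iff words_eq)
  qed
qed

text \<open>Source and target are annihilated together, as the same part is active in both. So steps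
  lead from highest weight words to highest weight words.\<close>

lemma E_step_None:
  assumes "\<gamma> \<in> steps" "E i (step_src X \<gamma>) = None"
  shows "E i (step_tgt X \<gamma>) = None"
proof -
  obtain t \<alpha> v where \<gamma>: "\<gamma> = (t, \<alpha>, v)" by (cases \<gamma>)
  show ?thesis
    using assms E_morphism[OF src_morphism, of t \<alpha> v i] E_morphism[OF tgt_morphism, of t \<alpha> v i]
    by (auto simp: \<gamma> split: if_split_asm)
qed

text \<open>Equal lengths align the parts of the two steps, so only the 2-generators could differ.
  They share \<open>eps\<close>, so neither is raised to the other; if both are raised to
  \<open>\<beta>\<close>, then \<open>f\<^sub>i\<close> applied to \<open>\<beta>\<close> gives
  both.\<close>

lemma e_lift_inj:
  assumes "\<gamma> \<in> steps" "\<delta> \<in> steps" "step_src X \<gamma> = step_src X \<delta>" "e_lift i \<gamma> \<gamma>'" "e_lift i \<delta> \<gamma>'"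
  shows "\<gamma> = \<delta>"
proof -
  obtain t \<alpha> v t' \<alpha>' v' t0 \<beta> v0 where eq: "\<gamma> = (t, \<alpha>, v)" "\<delta> = (t', \<alpha>', v')" "\<gamma>' = (t0, \<beta>, v0)"
    by (metis prod_cases3)
  have len: "length t = length t'" "length (src X \<alpha>) = length (src X \<alpha>')"
    using assms by (simp_all add: eq e_lift_def)
  with assms(3) have tv: "t = t'" "src X \<alpha> = src X \<alpha>'" "v = v'" by (simp_all add: eq)
  have carr: "\<alpha> \<in> carr (gen2 X)" "\<alpha>' \<in> carr (gen2 X)" using assms by (simp_all add: eq steps_iff)
  then have "eps (gen2 X) i \<alpha> = eps (gen2 X) i \<alpha>'" using src_word(2) tv by metis
  then have ne: "ce (gen2 X) i \<alpha> \<noteq> Some \<alpha>'" "ce (gen2 X) i \<alpha>' \<noteq> Some \<alpha>"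
    using B.ce_Some(2)[OF carr(1), of i \<alpha>'] B.ce_Some(2)[OF carr(2), of i \<alpha>] by auto
  have inj: "\<alpha> = \<alpha>'" if "ce (gen2 X) i \<alpha> = Some \<beta>" "ce (gen2 X) i \<alpha>' = Some \<beta>"
    using B.ce_Some(1)[OF carr(1) that(1)] B.ce_Some(1)[OF carr(2) that(2)] by simp
  have "\<alpha> = \<beta> \<or> ce (gen2 X) i \<alpha> = Some \<beta>" "\<alpha>' = \<beta> \<or> ce (gen2 X) i \<alpha>' = Some \<beta>"
    using assms by (simp_all add: eq e_lift_def)
  with ne inj have "\<alpha> = \<alpha>'" by blast
  then show ?thesis using tv by (simp add: eq)
qed

section \<open>Words and steps of highest weight\<close>

lemma highest_words: "highest (free_monoid (gen1 X)) = {w \<in> words X. \<forall>i. E i w = None}"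
  unfolding highest_def words_def by (simp add: free_monoid_def)

lemma highest_steps:
  "highest (step_crystal X) = {\<gamma> \<in> steps. \<forall>i. E i (step_src X \<gamma>) = None}"
proof -
  have "step_op X (E i) (ce (gen2 X) i) \<gamma> = None \<longleftrightarrow> E i (step_src X \<gamma>) = None"
    if \<gamma>: "\<gamma> \<in> steps" for i \<gamma>
  proof -
    obtain t \<alpha> v where eq: "\<gamma> = (t, \<alpha>, v)" by (cases \<gamma>)
    \<comment> \<open>Any nonzero result on the source has one of the three forms tested by
      \<open>step_op\<close>, so its default case means that the source is annihilated.\<close>
    have "(E i t \<noteq> None \<and> E i (t @ src X \<alpha> @ v) = Some (the (E i t) @ src X \<alpha> @ v)) \<or>
        (ce (gen2 X) i \<alpha> \<noteq> None \<and> E i (src X \<alpha>) \<noteq> None \<and>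
          E i (t @ src X \<alpha> @ v) = Some (t @ the (E i (src X \<alpha>)) @ v)) \<or>
        (E i v \<noteq> None \<and> E i (t @ src X \<alpha> @ v) = Some (t @ src X \<alpha> @ the (E i v)))"
      if "E i (t @ src X \<alpha> @ v) = Some w" for w
    proof -
      have "E i (src X \<alpha>) = map_option (src X) (ce (gen2 X) i \<alpha>)"
        using \<gamma> src_word(4) by (simp add: eq steps_iff)
      moreover have "E i (t @ src X \<alpha> @ v) \<in> {map_option (\<lambda>t'. t' @ src X \<alpha> @ v) (E i t),
          map_option (\<lambda>\<alpha>'. t @ src X \<alpha>' @ v) (ce (gen2 X) i \<alpha>), map_option (\<lambda>v'. t @ src X \<alpha> @ v') (E i v)}"
        unfolding E_morphism[OF src_morphism \<gamma>[unfolded eq]] by simp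
      ultimately show ?thesis
        using that
        by (cases "E i t"; cases "ce (gen2 X) i \<alpha>"; cases "E i v") auto
    qed
    then show ?thesis unfolding eq step_op.simps step_src.simps Let_def
      by (cases "E i (t @ src X \<alpha> @ v)") (simp_all only: option.distinct simp_thms if_True if_False split: if_split, blast)
  qed
  moreover have "ce (step_crystal X) i = step_op X (E i) (ce (gen2 X) i)" for i
    by (simp add: step_crystal_def free_monoid_def Let_def)
  ultimately show ?thesis by (simp add: highest_def cong: conj_cong)
qed

section \<open>Rewriting sequences as a relation on words\<close>

abbreviation "R \<equiv> rewriting X"
abbreviation "H \<equiv> rewriting_hw X"

text \<open>Forgets the steps, so that reflexive transitive closures and \<open>newman\<close>
  apply.\<close>

definition rew :: "('a list \<times> 'a list) set" where
  "rew = (\<lambda>\<gamma>. (step_src X \<gamma>, step_tgt X \<gamma>)) ` steps"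

lemma rewE:
  assumes "(x, y) \<in> rew"
  obtains \<gamma> where "\<gamma> \<in> steps" "step_src X \<gamma> = x" "step_tgt X \<gamma> = y"
  using assms unfolding rew_def by blast

lemma R_simps [simp]: "objs R = words X" "rsteps R = steps" "rsrc R = step_src X" "rtgt R = step_tgt X"
  by (simp_all add: rewriting_def)

lemma H_simps [simp]:
  "objs H = {w \<in> words X. \<forall>i. E i w = None}"
  "rsteps H = {\<gamma> \<in> steps. \<forall>i. E i (step_src X \<gamma>) = None}"
  "rsrc H = step_src X" "rtgt H = step_tgt X"
  by (simp_all add: rewriting_hw_def highest_words highest_steps)

lemma rewriting_seq_rew: "rewriting_seq R x p y \<Longrightarrow> (x, y) \<in> rew\<^sup>*"
  by (induction p arbitrary: x) (auto simp: rew_def intro: converse_rtrancl_into_rtrancl)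

lemma rew_rewriting_seq: "(x, y) \<in> rew\<^sup>* \<Longrightarrow> x \<in> words X \<Longrightarrow> \<exists>p. rewriting_seq R x p y"
proof (induction rule: converse_rtrancl_induct)
  case base then show ?case by (intro exI[of _ "[]"]) simp
next
  case (step x z)
  obtain \<gamma> where \<gamma>: "\<gamma> \<in> steps" "step_src X \<gamma> = x" "step_tgt X \<gamma> = z" using step.hyps(1) by (rule rewE)
  with step obtain p where "rewriting_seq R z p y" using step_tgt_words by blast
  with \<gamma> step.prems show ?case by (intro exI[of _ "\<gamma> # p"]) simp
qed

lemma joinable_iff:
  "y \<in> words X \<Longrightarrow> z \<in> words X \<Longrightarrow> joinable R y z \<longleftrightarrow> (\<exists>w. (y, w) \<in> rew\<^sup>* \<and> (z, w) \<in> rew\<^sup>*)"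
  unfolding joinable_def using rewriting_seq_rew rew_rewriting_seq by meson

lemma joinable_H: "joinable H y z \<Longrightarrow> joinable R y z"
proof -
  have "rewriting_seq H x p y \<Longrightarrow> rewriting_seq R x p y" for x p y
    by (induction p arbitrary: x) auto
  then show "joinable H y z \<Longrightarrow> joinable R y z" unfolding joinable_def by blast
qed

text \<open>By \<open>F_step\<close>, \<open>f\<^sub>i\<close> is defined on the target of a step
  whenever it is on the source, so it carries a whole sequence along.\<close>

lemma F_rew:
  assumes "(x, y) \<in> rew\<^sup>*" "F i x = Some x'"
  shows "\<exists>y'. F i y = Some y' \<and> (x', y') \<in> rew\<^sup>*"
  using assms
proof (induction arbitrary: x' rule: converse_rtrancl_induct)
  case (step x z)
  obtain \<gamma> where \<gamma>: "\<gamma> \<in> steps" "step_src X \<gamma> = x" "step_tgt X \<gamma> = z" using step.hyps(1) by (rule rewE)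
  then obtain \<gamma>' where \<gamma>': "\<gamma>' \<in> steps" "step_src X \<gamma>' = x'" "F i z = Some (step_tgt X \<gamma>')"
    using F_step step.prems by blast
  then obtain y' where "F i y = Some y'" "(step_tgt X \<gamma>', y') \<in> rew\<^sup>*" using step.IH by blast
  moreover have "(x', step_tgt X \<gamma>') \<in> rew" using \<gamma>' by (auto simp: rew_def)
  ultimately show ?case by (blast intro: converse_rtrancl_into_rtrancl)
qed auto

text \<open>\<open>f\<^sub>i\<close> undoes \<open>e\<^sub>i\<close> on the targets and carries both
  closing sequences back.\<close>

lemma confluent_e_lift:
  assumes "\<gamma> \<in> steps" "\<delta> \<in> steps" "e_lift i \<gamma> \<gamma>'" "e_lift i \<delta> \<delta>'"
    and "confluent_local_branching R (\<gamma>', \<delta>')"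
  shows "confluent_local_branching R (\<gamma>, \<delta>)"
proof -
  have F: "F i (step_tgt X \<gamma>') = Some (step_tgt X \<gamma>)" "F i (step_tgt X \<delta>') = Some (step_tgt X \<delta>)"
    using assms A.word_e_Some step_tgt_words unfolding e_lift_def words_eq by blast+
  have "\<gamma>' \<in> steps" "\<delta>' \<in> steps" using assms by (simp_all add: e_lift_def)
  then obtain w where w: "(step_tgt X \<gamma>', w) \<in> rew\<^sup>*" "(step_tgt X \<delta>', w) \<in> rew\<^sup>*"
    using assms(5) joinable_iff step_tgt_words by (auto simp: confluent_local_branching_def)
  obtain u where u: "F i w = Some u" "(step_tgt X \<gamma>, u) \<in> rew\<^sup>*" using F_rew[OF w(1) F(1)] by blast
  \<comment> \<open>Both sequences end at \<open>w\<close>, so their images end at the same word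
    \<open>u\<close>.\<close>
  moreover have "(step_tgt X \<delta>, u) \<in> rew\<^sup>*" using F_rew[OF w(2) F(2)] u(1) by auto
  ultimately show ?thesis
    using joinable_iff step_tgt_words assms by (auto simp: confluent_local_branching_def)
qed

section \<open>From highest weight to all words\<close>

lemma wf_E: "wf {(w', w). w \<in> words X \<and> (\<exists>i. E i w = Some w')}"
  using wf_word_e[OF datum, of "gen1 X"] polygraph by (simp add: crystal_2polygraph_def words_eq)

text \<open>Induction on the common source along the raising operators. \<open>P\<close> is left
  open so that one induction serves both parts: it is trivial in (i) and criticality in
  (ii).\<close>

lemma confluent_from_highest:
  assumes closed: "\<And>i \<gamma> \<delta> \<gamma>' \<delta>'. (\<gamma>, \<delta>) \<in> local_branchings R \<Longrightarrow> P \<gamma> \<delta> \<Longrightarrow>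
      e_lift i \<gamma> \<gamma>' \<Longrightarrow> e_lift i \<delta> \<delta>' \<Longrightarrow> P \<gamma>' \<delta>'"
    and highest: "\<And>\<gamma> \<delta>. (\<gamma>, \<delta>) \<in> local_branchings H \<Longrightarrow> P \<gamma> \<delta> \<Longrightarrow> confluent_local_branching H (\<gamma>, \<delta>)"
  shows "(\<gamma>, \<delta>) \<in> local_branchings R \<Longrightarrow> P \<gamma> \<delta> \<Longrightarrow> confluent_local_branching R (\<gamma>, \<delta>)"
proof (induction "step_src X \<gamma>" arbitrary: \<gamma> \<delta> rule: wf_induct_rule[OF wf_E])
  case 1
  then have s: "\<gamma> \<in> steps" "\<delta> \<in> steps" "step_src X \<gamma> = step_src X \<delta>"
    by (simp_all add: local_branchings_def)
  show ?case
  proof (cases "\<forall>i. E i (step_src X \<gamma>) = None")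
    case True
    then have "(\<gamma>, \<delta>) \<in> local_branchings H" using s by (simp add: local_branchings_def)
    then show ?thesis
      using highest[of \<gamma> \<delta>] 1 joinable_H by (auto simp: confluent_local_branching_def)
  next
    case False
    then obtain i where "E i (step_src X \<gamma>) \<noteq> None" by blast
    then obtain \<gamma>' \<delta>' where l: "e_lift i \<gamma> \<gamma>'" "e_lift i \<delta> \<delta>'"
      using e_lift_exists s by metis
    then have "(\<gamma>', \<delta>') \<in> local_branchings R"
      using s by (auto simp: local_branchings_def e_lift_def)
    moreover have "P \<gamma>' \<delta>'" using closed 1 l by blast
    moreover have "(step_src X \<gamma>', step_src X \<gamma>) \<in> {(w', w). w \<in> words X \<and> (\<exists>i. E i w = Some w')}"
      using l step_src_words s by (auto simp: e_lift_def)
    ultimately have "confluent_local_branching R (\<gamma>', \<delta>')" using 1(1) by blast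
    then show ?thesis using confluent_e_lift s l by blast
  qed
qed

lemma terminating_from_highest:
  assumes "terminating H"
  shows "terminating R"
proof -
  have "\<not> (\<forall>n. \<gamma> n \<in> steps \<and> step_tgt X (\<gamma> n) = step_src X (\<gamma> (Suc n)))" for \<gamma>
  proof (induction "step_src X (\<gamma> 0)" arbitrary: \<gamma> rule: wf_induct_rule[OF wf_E])
    case 1
    show ?case
    proof
      assume \<gamma>: "\<forall>n. \<gamma> n \<in> steps \<and> step_tgt X (\<gamma> n) = step_src X (\<gamma> (Suc n))"
      show False
      proof (cases "\<forall>i. E i (step_src X (\<gamma> 0)) = None")
        case True
        \<comment> \<open>From a highest weight start, all later words are of highest weight, so the
          sequence lies in \<open>H\<close>.\<close>
        then have "\<forall>i. E i (step_src X (\<gamma> n)) = None" for n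
        proof (induction n)
          case (Suc n)
          then show ?case using \<gamma> E_step_None by metis
        qed (use True in simp)
        then show False using assms \<gamma> by (auto simp: terminating_def)
      next
        case False
        then obtain i where i: "E i (step_src X (\<gamma> 0)) \<noteq> None" by blast
        \<comment> \<open>A lift also raises the target, which is the next source; so one
          \<open>i\<close> lifts the whole sequence.\<close>
        have "E i (step_src X (\<gamma> n)) \<noteq> None" for n
        proof (induction n)
          case (Suc n)
          then obtain \<delta> where "e_lift i (\<gamma> n) \<delta>" using e_lift_exists \<gamma> by metis
          then show ?case using \<gamma> by (metis e_lift_def option.distinct(1))
        qed (use i in simp)
        then have "\<forall>n. \<exists>\<delta>. e_lift i (\<gamma> n) \<delta>" using e_lift_exists \<gamma> by metis
        then obtain \<delta> where \<delta>: "\<And>n. e_lift i (\<gamma> n) (\<delta> n)" by metis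
        have "\<delta> n \<in> steps \<and> step_tgt X (\<delta> n) = step_src X (\<delta> (Suc n))" for n
          using \<delta>[of n] \<delta>[of "Suc n"] \<gamma> by (simp add: e_lift_def)
        moreover have "(step_src X (\<delta> 0), step_src X (\<gamma> 0)) \<in> {(w', w). w \<in> words X \<and> (\<exists>i. E i w = Some w')}"
          using \<delta>[of 0] \<gamma> step_src_words by (auto simp: e_lift_def)
        ultimately show False using 1 by blast
      qed
    qed
  qed
  then show ?thesis by (auto simp: terminating_def)
qed

lemma confluent_from_local:
  assumes "terminating R" "locally_confluent R"
  shows "confluent R"
proof -
  have "wf (rew\<inverse>)"
    unfolding wf_iff_no_infinite_down_chain
  proof
    assume "\<exists>x. \<forall>n. (x (Suc n), x n) \<in> rew\<inverse>"
    then obtain x where x: "\<forall>n. (x n, x (Suc n)) \<in> rew" by auto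
    have "\<exists>\<gamma>. \<gamma> \<in> steps \<and> step_src X \<gamma> = x n \<and> step_tgt X \<gamma> = x (Suc n)" for n
      using x rewE[of "x n" "x (Suc n)"] by blast
    then have "\<forall>n. \<exists>\<gamma>. \<gamma> \<in> steps \<and> step_src X \<gamma> = x n \<and> step_tgt X \<gamma> = x (Suc n)" by blast
    then have "\<exists>\<gamma>. \<forall>n. \<gamma> n \<in> steps \<and> step_src X (\<gamma> n) = x n \<and> step_tgt X (\<gamma> n) = x (Suc n)"
      by (rule choice)
    then have "\<exists>\<gamma>. \<forall>n. \<gamma> n \<in> steps \<and> step_tgt X (\<gamma> n) = step_src X (\<gamma> (Suc n))" by fastforce
    then show False using assms(1) by (simp add: terminating_def)
  qed
  moreover have "\<exists>w. (y, w) \<in> rew\<^sup>* \<and> (z, w) \<in> rew\<^sup>*" if xyz: "(x, y) \<in> rew" "(x, z) \<in> rew" for x y z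
  proof -
    obtain \<gamma> where \<gamma>: "\<gamma> \<in> steps" "step_src X \<gamma> = x" "step_tgt X \<gamma> = y" using xyz(1) by (rule rewE)
    obtain \<delta> where \<delta>: "\<delta> \<in> steps" "step_src X \<delta> = x" "step_tgt X \<delta> = z" using xyz(2) by (rule rewE)
    have "(\<gamma>, \<delta>) \<in> local_branchings R" using \<gamma> \<delta> by (simp add: local_branchings_def)
    then have "confluent_local_branching R (\<gamma>, \<delta>)" using assms(2) by (simp add: locally_confluent_def)
    then have "joinable R y z" using \<gamma> \<delta> by (simp add: confluent_local_branching_def)
    then show ?thesis using joinable_iff[of y z] step_tgt_words \<gamma> \<delta> by blast
  qed
  ultimately have join: "\<exists>w. (y, w) \<in> rew\<^sup>* \<and> (z, w) \<in> rew\<^sup>*" if "(x, y) \<in> rew\<^sup>*" "(x, z) \<in> rew\<^sup>*" for x y z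
    using newman[OF _ _ that] by blast
  have target: "rewriting_seq R x p y \<Longrightarrow> y \<in> words X" for x p y
    by (induction p arbitrary: x) auto
  show ?thesis
    unfolding confluent_def
  proof (intro allI impI, elim conjE)
    fix x p q y z assume "rewriting_seq R x p y" "rewriting_seq R x q z"
    then show "joinable R y z"
      using join[of x y z] rewriting_seq_rew target joinable_iff[of y z] by blast
  qed
qed

section \<open>Critical branchings in terms of lengths\<close>

lemma peiffer_ordered:
  assumes "t @ src X \<alpha> @ v = t' @ src X \<alpha>' @ v'" "(t, \<alpha>, v) \<in> steps" "(t', \<alpha>', v') \<in> steps"
    "length t + length (src X \<alpha>) \<le> length t'"
  shows "\<exists>\<gamma> \<in> steps. \<exists>\<delta> \<in> steps. (t, \<alpha>, v) = whisker [] \<gamma> (step_src X \<delta>)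
     \<and> (t', \<alpha>', v') = whisker (step_src X \<gamma>) \<delta> []"
proof -
  have "(t @ src X \<alpha>) @ v = t' @ src X \<alpha>' @ v'" using assms(1) by simp
  \<comment> \<open>\<open>us\<close> is the factor between the two rewritten ones.\<close>
  then obtain us where us: "t' = (t @ src X \<alpha>) @ us" "us @ src X \<alpha>' @ v' = v"
    using assms(4) by (auto simp: append_eq_append_conv2)
  have "(t, \<alpha>, us) \<in> steps" "([], \<alpha>', v') \<in> steps"
    using assms(2,3) us by (simp_all add: steps_iff words_append) (simp add: words_eq)
  then show ?thesis using us
    by (intro bexI[of _ "(t, \<alpha>, us)"] bexI[of _ "([], \<alpha>', v')"]) simp_all
qed

lemma peiffer_iff:
  assumes "((t, \<alpha>, v), (t', \<alpha>', v')) \<in> local_branchings R"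
  shows "peiffer X ((t, \<alpha>, v), (t', \<alpha>', v')) \<longleftrightarrow>
     length t + length (src X \<alpha>) \<le> length t' \<or> length t' + length (src X \<alpha>') \<le> length t"
proof
  assume "peiffer X ((t, \<alpha>, v), (t', \<alpha>', v'))"
  then show "length t + length (src X \<alpha>) \<le> length t' \<or> length t' + length (src X \<alpha>') \<le> length t"
    by (auto simp: peiffer_def Let_def)
next
  have eq: "t @ src X \<alpha> @ v = t' @ src X \<alpha>' @ v'" "(t, \<alpha>, v) \<in> steps" "(t', \<alpha>', v') \<in> steps"
    using assms by (simp_all add: local_branchings_def)
  assume "length t + length (src X \<alpha>) \<le> length t' \<or> length t' + length (src X \<alpha>') \<le> length t"
  then show "peiffer X ((t, \<alpha>, v), (t', \<alpha>', v'))"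
    using peiffer_ordered[OF eq] peiffer_ordered[OF eq(1)[symmetric] eq(3,2)]
    unfolding peiffer_def Let_def by metis
qed

text \<open>One common outer letter is removed. This refutes minimality and also feeds the induction
  on length in \<open>confluent_from_critical\<close>.\<close>

lemma strip_branching:
  assumes "((t, \<alpha>, v), (t', \<alpha>', v')) \<in> local_branchings R"
    and "t \<noteq> [] \<and> t' \<noteq> [] \<or> v \<noteq> [] \<and> v' \<noteq> []"
  shows "\<exists>b \<in> local_branchings R. branching_le X b ((t, \<alpha>, v), (t', \<alpha>', v')) \<and>
      length (step_src X (fst b)) < length (step_src X (t, \<alpha>, v))"
proof -
  have eq: "t @ src X \<alpha> @ v = t' @ src X \<alpha>' @ v'" "(t, \<alpha>, v) \<in> steps" "(t', \<alpha>', v') \<in> steps"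
    using assms(1) by (simp_all add: local_branchings_def)
  have nil: "[] \<in> words X" by (simp add: words_eq)
  from assms(2) show ?thesis
  proof
    assume "t \<noteq> [] \<and> t' \<noteq> []"
    then obtain x s y s' where t: "t = x # s" "t' = y # s'" by (meson neq_Nil_conv)
    then have xy: "x = y" using eq(1) by simp
    have x: "[x] \<in> words X" using eq(2) by (simp add: t steps_iff words_eq)
    have "((s, \<alpha>, v), (s', \<alpha>', v')) \<in> local_branchings R"
      using eq t by (simp add: local_branchings_def steps_iff words_eq)
    moreover have "branching_le X ((s, \<alpha>, v), (s', \<alpha>', v')) ((t, \<alpha>, v), (t', \<alpha>', v'))"
      unfolding branching_le_def using x nil by (intro bexI[of _ "[x]"] bexI[of _ "[]"]) (simp_all add: t xy)
    ultimately show ?thesis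
      by (intro bexI[of _ "((s, \<alpha>, v), (s', \<alpha>', v'))"]) (simp_all add: t)
  next
    assume "v \<noteq> [] \<and> v' \<noteq> []"
    then obtain x s y s' where v: "v = s @ [x]" "v' = s' @ [y]" by (meson rev_exhaust)
    have "(t @ src X \<alpha> @ s) @ [x] = (t' @ src X \<alpha>' @ s') @ [y]" using eq(1) v by simp
    then have xy: "x = y" "t @ src X \<alpha> @ s = t' @ src X \<alpha>' @ s'" by (simp_all only: append1_eq_conv)
    have x: "[x] \<in> words X" using eq(2) by (simp add: v steps_iff words_eq)
    have "((t, \<alpha>, s), (t', \<alpha>', s')) \<in> local_branchings R"
      using eq v xy by (simp add: local_branchings_def steps_iff words_eq)
    moreover have "branching_le X ((t, \<alpha>, s), (t', \<alpha>', s')) ((t, \<alpha>, v), (t', \<alpha>', v'))"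
      unfolding branching_le_def using x nil by (intro bexI[of _ "[]"] bexI[of _ "[x]"]) (simp_all add: v xy)
    ultimately show ?thesis
      by (intro bexI[of _ "((t, \<alpha>, s), (t', \<alpha>', s'))"]) (simp_all add: v)
  qed
qed

text \<open>Turns criticality into a condition that can be compared before and after raising:
  besides distinctness, only lengths enter.\<close>

lemma critical_iff:
  assumes "((t, \<alpha>, v), (t', \<alpha>', v')) \<in> local_branchings R"
  shows "((t, \<alpha>, v), (t', \<alpha>', v')) \<in> critical_branchings X \<longleftrightarrow>
     (t, \<alpha>, v) \<noteq> (t', \<alpha>', v') \<and>
     length t' < length t + length (src X \<alpha>) \<and> length t < length t' + length (src X \<alpha>') \<and>
     (t = [] \<or> t' = []) \<and> (v = [] \<or> v' = [])"
proof -
  let ?c = "((t, \<alpha>, v), (t', \<alpha>', v'))"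
  have overlap: "?c \<in> overlapping_branchings X \<longleftrightarrow> (t, \<alpha>, v) \<noteq> (t', \<alpha>', v') \<and>
     length t' < length t + length (src X \<alpha>) \<and> length t < length t' + length (src X \<alpha>')"
    using assms peiffer_iff[OF assms] by (auto simp: overlapping_branchings_def aspherical_def)
  have "(\<forall>b \<in> local_branchings R. branching_le X b ?c \<longrightarrow> b = ?c) \<longleftrightarrow>
     (t = [] \<or> t' = []) \<and> (v = [] \<or> v' = [])"
  proof
    assume "\<forall>b \<in> local_branchings R. branching_le X b ?c \<longrightarrow> b = ?c"
    then have "\<not> (\<exists>b \<in> local_branchings R. branching_le X b ?c \<and>
        length (step_src X (fst b)) < length (step_src X (t, \<alpha>, v)))" by fastforce
    then show "(t = [] \<or> t' = []) \<and> (v = [] \<or> v' = [])" using strip_branching[OF assms] by blast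
  next
    assume nil: "(t = [] \<or> t' = []) \<and> (v = [] \<or> v' = [])"
    show "\<forall>b \<in> local_branchings R. branching_le X b ?c \<longrightarrow> b = ?c"
    proof (intro ballI impI)
      fix b assume "branching_le X b ?c"
      then obtain u w where "?c = (whisker u (fst b) w, whisker u (snd b) w)"
        by (auto simp: branching_le_def)
      moreover obtain t1 \<beta> v1 t1' \<beta>' v1' where b: "b = ((t1, \<beta>, v1), (t1', \<beta>', v1'))"
        by (metis prod.exhaust)
      \<comment> \<open>\<open>u\<close> is a prefix of both left parts and \<open>w\<close> a
        suffix of both right parts; an empty part on each side forces both to be empty.\<close>
      ultimately show "b = ?c" using nil by auto
    qed
  qed
  with overlap show ?thesis by (auto simp: critical_branchings_def)
qed

text \<open>The lengths in \<open>critical_iff\<close> are preserved by \<open>e_lift\<close>, and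
  distinctness by \<open>e_lift_inj\<close>.\<close>

lemma critical_e_lift:
  assumes lb: "(\<gamma>, \<delta>) \<in> local_branchings R" and crit: "(\<gamma>, \<delta>) \<in> critical_branchings X"
    and lift: "e_lift i \<gamma> \<gamma>'" "e_lift i \<delta> \<delta>'"
  shows "(\<gamma>', \<delta>') \<in> critical_branchings X"
proof -
  have s: "\<gamma> \<in> steps" "\<delta> \<in> steps" "step_src X \<gamma> = step_src X \<delta>"
    using lb by (simp_all add: local_branchings_def)
  have lb': "(\<gamma>', \<delta>') \<in> local_branchings R"
    using s lift by (auto simp: local_branchings_def e_lift_def)
  obtain t \<alpha> v t' \<alpha>' v' where eq: "\<gamma> = (t, \<alpha>, v)" "\<delta> = (t', \<alpha>', v')" by (metis prod_cases3)
  obtain t1 \<alpha>1 v1 t1' \<alpha>1' v1' where eq1: "\<gamma>' = (t1, \<alpha>1, v1)" "\<delta>' = (t1', \<alpha>1', v1')"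
    by (metis prod_cases3)
  have crit_neq: "\<gamma> \<noteq> \<delta>"
    using critical_iff[OF lb[unfolded eq]] crit by (simp add: eq)
  then have neq: "\<gamma>' \<noteq> \<delta>'" using e_lift_inj[OF s] lift by blast
  have len: "length t = length t1" "length t' = length t1'" "length v = length v1" "length v' = length v1'"
    "length (src X \<alpha>) = length (src X \<alpha>1)" "length (src X \<alpha>') = length (src X \<alpha>1')"
    using lift by (simp_all add: e_lift_def eq eq1)
  then have nil: "t = [] \<longleftrightarrow> t1 = []" "t' = [] \<longleftrightarrow> t1' = []" "v = [] \<longleftrightarrow> v1 = []" "v' = [] \<longleftrightarrow> v1' = []"
    by (metis length_0_conv)+
  show ?thesis
    using crit neq len nil
    unfolding eq eq1 critical_iff[OF lb[unfolded eq]] critical_iff[OF lb'[unfolded eq1]] by simp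
qed

section \<open>Reduction to critical branchings\<close>

lemma rew_context:
  assumes "(x, y) \<in> rew\<^sup>*" "u \<in> words X" "v \<in> words X"
  shows "(u @ x @ v, u @ y @ v) \<in> rew\<^sup>*"
  using assms(1)
proof (induction rule: rtrancl_induct)
  case (step y z)
  then obtain t \<alpha> w where "(t, \<alpha>, w) \<in> steps" "y = t @ src X \<alpha> @ w" "z = t @ tgt X \<alpha> @ w"
    by (auto simp: rew_def)
  then have "(u @ y @ v, u @ z @ v) \<in> rew" unfolding rew_def
    by (intro image_eqI[of _ _ "(u @ t, \<alpha>, w @ v)"]) (use assms in \<open>simp_all add: steps_iff words_append\<close>)
  with step show ?case by simp
qed simp

lemma step_tgt_whisker: "step_tgt X (whisker u \<gamma> v) = u @ step_tgt X \<gamma> @ v"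
  by (cases \<gamma>) simp

lemma confluent_branching_le:
  assumes "b \<in> local_branchings R" "c \<in> local_branchings R" "branching_le X b c" "confluent_local_branching R b"
  shows "confluent_local_branching R c"
proof -
  obtain u v where uv: "u \<in> words X" "v \<in> words X" and c: "c = (whisker u (fst b) v, whisker u (snd b) v)"
    using assms(3) by (auto simp: branching_le_def)
  have "fst b \<in> steps" "snd b \<in> steps" "fst c \<in> steps" "snd c \<in> steps"
    using assms(1,2) by (auto simp: local_branchings_def)
  note w = this[THEN step_tgt_words]
  then obtain z where "(step_tgt X (fst b), z) \<in> rew\<^sup>*" "(step_tgt X (snd b), z) \<in> rew\<^sup>*"
    using assms(4) joinable_iff by (auto simp: confluent_local_branching_def)
  then have "(step_tgt X (fst c), u @ z @ v) \<in> rew\<^sup>*" "(step_tgt X (snd c), u @ z @ v) \<in> rew\<^sup>*"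
    using rew_context[OF _ uv] by (simp_all add: c step_tgt_whisker)
  then show ?thesis using joinable_iff w by (auto simp: confluent_local_branching_def)
qed

text \<open>On disjoint factors each step still applies after the other, and both orders end at the
  concatenation of the two targets.\<close>

lemma confluent_peiffer:
  assumes "\<gamma> \<in> steps" "\<delta> \<in> steps"
  shows "\<exists>z. (step_tgt X (whisker [] \<gamma> (step_src X \<delta>)), z) \<in> rew\<^sup>* \<and>
             (step_tgt X (whisker (step_src X \<gamma>) \<delta> []), z) \<in> rew\<^sup>*"
proof -
  have nil: "[] \<in> words X" by (simp add: words_eq)
  have "(step_src X \<gamma>, step_tgt X \<gamma>) \<in> rew\<^sup>*" "(step_src X \<delta>, step_tgt X \<delta>) \<in> rew\<^sup>*"
    using assms by (auto simp: rew_def)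
  then have "([] @ step_src X \<gamma> @ step_tgt X \<delta>, [] @ step_tgt X \<gamma> @ step_tgt X \<delta>) \<in> rew\<^sup>*"
    "(step_tgt X \<gamma> @ step_src X \<delta> @ [], step_tgt X \<gamma> @ step_tgt X \<delta> @ []) \<in> rew\<^sup>*"
    using rew_context nil step_tgt_words assms by blast+
  then show ?thesis by (auto simp: step_tgt_whisker)
qed

text \<open>A branching that is not trivial, Peiffer or critical loses a common outer letter; the
  induction hypothesis closes the shorter one, and the context carries this over.\<close>

lemma confluent_from_critical:
  assumes crit: "\<forall>b \<in> critical_branchings X. confluent_local_branching R b"
  shows "(\<gamma>, \<delta>) \<in> local_branchings R \<Longrightarrow> confluent_local_branching R (\<gamma>, \<delta>)"
proof (induction "length (step_src X \<gamma>)" arbitrary: \<gamma> \<delta> rule: less_induct)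
  case less
  obtain t \<alpha> v t' \<alpha>' v' where eq: "\<gamma> = (t, \<alpha>, v)" "\<delta> = (t', \<alpha>', v')" by (metis prod_cases3)
  have s: "\<gamma> \<in> steps" "\<delta> \<in> steps" using less.prems by (simp_all add: local_branchings_def)
  note w = s[THEN step_tgt_words]
  consider "\<gamma> = \<delta>" | "peiffer X (\<gamma>, \<delta>)" | "(\<gamma>, \<delta>) \<in> critical_branchings X"
    | "t \<noteq> [] \<and> t' \<noteq> [] \<or> v \<noteq> [] \<and> v' \<noteq> []"
    using critical_iff[OF less.prems[unfolded eq]] peiffer_iff[OF less.prems[unfolded eq]]
    unfolding eq by (meson not_le)
  then show ?case
  proof cases
    case 1 then show ?thesis using joinable_iff w by (auto simp: confluent_local_branching_def)
  next
    case 2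
    then obtain \<gamma>0 \<delta>0 where "\<gamma>0 \<in> steps" "\<delta>0 \<in> steps" and
      "(\<gamma>, \<delta>) = (whisker [] \<gamma>0 (step_src X \<delta>0), whisker (step_src X \<gamma>0) \<delta>0 []) \<or>
       (\<gamma>, \<delta>) = (whisker (step_src X \<gamma>0) \<delta>0 [], whisker [] \<gamma>0 (step_src X \<delta>0))"
      unfolding peiffer_def Let_def by blast
    then have "\<exists>z. (step_tgt X \<gamma>, z) \<in> rew\<^sup>* \<and> (step_tgt X \<delta>, z) \<in> rew\<^sup>*"
      using confluent_peiffer[of \<gamma>0 \<delta>0] by auto
    then show ?thesis using joinable_iff w by (simp add: confluent_local_branching_def)
  next
    case 3 then show ?thesis using crit by blast
  next
    case 4
    then obtain b where b: "b \<in> local_branchings R" "branching_le X b (\<gamma>, \<delta>)"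
        "length (step_src X (fst b)) < length (step_src X \<gamma>)"
      using strip_branching[OF less.prems[unfolded eq]] unfolding eq by blast
    then have "confluent_local_branching R b" using less.hyps[of "fst b" "snd b"] by simp
    then show ?thesis using confluent_branching_le b less.prems by blast
  qed
qed

end

theorem corollary3p3p5:
  fixes D :: "('i::finite, 'r::finite) datum" and X :: "('a, 'b, 'i, 'r) polygraph"
  assumes "kac_moody_datum D" and "crystal_2polygraph D X"
  shows "(terminating (rewriting_hw X) \<and> locally_confluent (rewriting_hw X) \<longrightarrow>
            terminating (rewriting X) \<and> confluent (rewriting X)) \<and>
         ((\<forall>b \<in> critical_branchings_hw X. confluent_local_branching (rewriting_hw X) b) \<longrightarrow>
            locally_confluent (rewriting X))"
proof (intro conjI impI)
  interpret crystal_polygraph D X using assms by unfold_locales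
  assume *: "terminating (rewriting_hw X) \<and> locally_confluent (rewriting_hw X)"
  then show "terminating (rewriting X)" using terminating_from_highest by blast
  moreover have "locally_confluent (rewriting X)"
    \<comment> \<open>The trivial property is stable under raising, so every local branching can be
      moved to highest weight.\<close>
    using * confluent_from_highest[of "\<lambda>_ _. True"] by (auto simp: locally_confluent_def)
  ultimately show "confluent (rewriting X)" by (rule confluent_from_local)
next
  interpret crystal_polygraph D X using assms by unfold_locales
  assume *: "\<forall>b \<in> critical_branchings_hw X. confluent_local_branching (rewriting_hw X) b"
  have "confluent_local_branching R (\<gamma>, \<delta>)" if "(\<gamma>, \<delta>) \<in> critical_branchings X" for \<gamma> \<delta>
  \<comment> \<open>The branching stays critical while it is raised, so the hypothesis applies once
    its source is of highest weight.\<close>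
  proof (rule confluent_from_highest[where P = "\<lambda>\<gamma> \<delta>. (\<gamma>, \<delta>) \<in> critical_branchings X"])
    show "(\<gamma>, \<delta>) \<in> local_branchings R"
      using that by (simp add: critical_branchings_def overlapping_branchings_def)
  qed (use that * critical_e_lift in \<open>auto simp: critical_branchings_hw_def\<close>)
  then have "\<forall>b \<in> critical_branchings X. confluent_local_branching R b" by auto
  then show "locally_confluent (rewriting X)"
    using confluent_from_critical by (auto simp only: locally_confluent_def)
qed

end
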